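(* Let $q$ be a power of an odd prime and $U=UU_n(\mathbb F_{q^2})$. The superclasses and supercharacters of $U$, in the supercharacter theory with superclasses $\{K_u\mid u\in U\}$ and supercharacters $\{\chi_\lambda\mid\lambda\in\mathfrak u^*\}$, are given respectively by $$\{K_{u_\eta}\mid\eta\text{ is a twisted }\mathbb F_q\text{-set partition}\}\quad\text{and}\quad\{\chi^\eta\mid\eta\text{ is a twisted }\mathbb F_q\text{-set partition}\},$$ where $\chi^\eta=\chi_{\lambda_\eta}$.
   Context: $G=UT_n(\mathbb F_{q^2})$ (unipotent upper triangular matrices), $\mathfrak g=\mathfrak{ut}_n(\mathbb F_{q^2})$ (strictly upper triangular matrices, viewed as an $\mathbb F_q$-algebra), $\bar i=n+1-i$. For $x\in\mathfrak g$ let $\overline x$ be the matrix with entries $(x_{ij})^q$, $J$ the matrix with ones on the antidiagonal and zeroes elsewhere, $x^\dagger=J\overline x^tJ$, and $(1+x)^\dagger=1+x^\dagger$. $U=UU_n(\mathbb F_{q^2})=\{g\in G\mid g^{-1}=g^\dagger\}$, $\mathfrak u=\{x\in\mathfrak g\mid x^\dagger=-x\}$, and $\mathfrak u^*$ is its $\mathbb F_q$-dual. $G$ acts on $\mathfrak u$ by $g\cdot x=gxg^\dagger$ and on $\mathfrak u^*$ by $(g\cdot\lambda)(x)=\lambda(g^{-1}\cdot x)$. Let $H=1+\mathfrak h$ with $\mathfrak h=\{x\in\mathfrak g\mid x_{ij}=0\text{ if }j\le n/2\}$. Fix a Springer morphism $f:G\to\mathfrak g$, i.e. a bijection with $f(U)=\mathfrak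 u$ and $f(1+x)=x+\sum_{i\ge2}a_ix^i$ for some $a_i\in\mathbb F_q$, and a nontrivial homomorphism $\theta:\mathbb F_q^+\to\mathbb C^\times$. Define $$K_u=\{v\in U\mid f(v)\in G\cdot f(u)\},\qquad \chi_\lambda=\frac{|H\cdot\lambda|}{|G\cdot\lambda|}\sum_{\mu\in G\cdot\lambda}\theta\circ\mu\circ f .$$ An $\mathbb F_{q^2}$-set partition of $[n]$ is a set of labeled arcs $i\overset{a}{\frown}j$ with $1\le i<j\le n$, $a\in\mathbb F_{q^2}^\times$, such that each $i$ is the left endpoint of at most one arc and each $j$ is the right endpoint of at most one arc. A twisted $\mathbb F_q$-set partition is an $\mathbb F_{q^2}$-set partition $\eta$ of $[n]$ such that $i\overset{a}{\frown}j\in\eta$ implies $\bar j\overset{-a^q}{\frown}\bar i\in\eta$. For such $\eta$: $x_\eta\in\mathfrak u$ has $(i,j)$ entry $a$ if $i\overset{a}{\frown}j\in\eta$ and $0$ otherwise; $u_\eta\in U$ is the element with $f(u_\eta)=x_\eta$; $\lambda_\eta\in\mathfrak u^*$ is $\lambda_\eta(x)=\sum_{i\overset{a}{\frown}j\in\eta}ax_{ij}$ (which lies in $\mathbb F_q$ for $x\in\mathfrak u$). *)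

theory Defs
  imports "Jordan_Normal_Form.Matrix" "HOL-Library.FuncSet" "HOL-Library.Cardinality"
    "HOL-Computational_Algebra.Primes"
begin

text \<open>
  The type \<open>'a\<close> is a finite field with \<open>q\<^sup>2\<close> elements. Matrix indices run over \<open>{0..<n}\<close>
  instead of \<open>{1..n}\<close>; so the index opposite to \<open>i\<close> is \<open>n - 1 - i\<close>.
\<close>

text \<open>The subfield with \<open>q\<close> elements.\<close>

definition Fq :: "nat \<Rightarrow> 'a::field set" where
  "Fq q = {c. c ^ q = c}"

definition opp :: "nat \<Rightarrow> nat \<Rightarrow> nat" where
  "opp n i = n - 1 - i"

definition UT :: "nat \<Rightarrow> 'a::field mat monoid" where
  "UT n = \<lparr>carrier = {g \<in> carrier_mat n n. upper_triangular g \<and> (\<forall>i<n. g $$ (i, i) = 1)},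
           mult = (*), one = 1\<^sub>m n\<rparr>"

definition ut :: "nat \<Rightarrow> 'a::field mat set" where
  "ut n = {x \<in> carrier_mat n n. \<forall>i<n. \<forall>j\<le>i. x $$ (i, j) = 0}"

definition antidiag :: "nat \<Rightarrow> 'a::field mat" where
  "antidiag n = mat n n (\<lambda>(i, j). if j = opp n i then 1 else 0)"

definition dagger :: "nat \<Rightarrow> nat \<Rightarrow> 'a::field mat \<Rightarrow> 'a mat" where
  "dagger q n x = antidiag n * transpose_mat (map_mat (\<lambda>c. c ^ q) x) * antidiag n"

text \<open>The two formulas that determine \<open>dagger\<close>: entrywise, and compatibility with \<open>1 + x\<close>.\<close>

lemma dim_dagger: "dim_row (dagger q n x) = n" "dim_col (dagger q n x) = n"
  by (simp_all add: dagger_def antidiag_def)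

lemma dagger_index:
  assumes x: "x \<in> carrier_mat n n" and i: "i < n" and j: "j < n"
  shows "dagger q n x $$ (i, j) = (x $$ (opp n j, opp n i)) ^ q"
proof -
  let ?y = "transpose_mat (map_mat (\<lambda>c. c ^ q) x)"
  have opp: "opp n i < n" "opp n j < n" using i j by (simp_all add: opp_def)
  have eq: "j = opp n k \<longleftrightarrow> k = opp n j" if "k < n" for k
    using that j unfolding opp_def by linarith
  have dims: "dim_row x = n" "dim_col x = n" using x by simp_all
  have *: "(antidiag n * ?y) $$ (i, k) = (x $$ (k, opp n i)) ^ q" if k: "k < n" for k
  proof -
    have "(antidiag n * ?y) $$ (i, k) = (\<Sum>m = 0..<n. antidiag n $$ (i, m) * ?y $$ (m, k))"
      using i k dims by (simp add: scalar_prod_def antidiag_def)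
    also have "\<dots> = (\<Sum>m = 0..<n. if m = opp n i then (x $$ (k, m)) ^ q else 0)"
      using i k dims by (intro sum.cong refl) (simp add: antidiag_def)
    finally show ?thesis using opp by simp
  qed
  have "dagger q n x $$ (i, j) =
      (\<Sum>m = 0..<n. (antidiag n * ?y) $$ (i, m) * antidiag n $$ (m, j))"
    unfolding dagger_def using i j dims
    by (subst index_mult_mat(1)) (simp_all add: scalar_prod_def antidiag_def)
  also have "\<dots> = (\<Sum>m = 0..<n. if m = opp n j then (x $$ (m, opp n i)) ^ q else 0)"
  proof (intro sum.cong refl)
    fix m assume "m \<in> {0..<n}"
    then have m: "m < n" by simp
    have "antidiag n $$ (m, j) = (if m = opp n j then 1 else 0 :: 'a)"
      using m j eq[OF m] by (simp add: antidiag_def)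
    then show "(antidiag n * ?y) $$ (i, m) * antidiag n $$ (m, j) =
        (if m = opp n j then (x $$ (m, opp n i)) ^ q else 0)"
      by (simp add: *[OF m])
  qed
  finally show ?thesis using opp by simp
qed

lemma dagger_one_plus:
  assumes x: "x \<in> ut n" and q: "q > 0"
  shows "dagger q n (1\<^sub>m n + x) = 1\<^sub>m n + dagger q n x"
proof (rule eq_matI)
  have xc: "x \<in> carrier_mat n n" using x by (simp add: ut_def)
  have yc: "1\<^sub>m n + x \<in> carrier_mat n n" using xc by simp
  fix i j assume "i < dim_row (1\<^sub>m n + dagger q n x)" "j < dim_col (1\<^sub>m n + dagger q n x)"
  then have i: "i < n" and j: "j < n" by (simp_all add: dim_dagger)
  have o: "opp n i < n" "opp n j < n" using i j by (simp_all add: opp_def)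
  have e: "opp n j = opp n i \<longleftrightarrow> i = j" using i j unfolding opp_def by linarith
  have z: "x $$ (opp n i, opp n i) = 0" using x o by (simp add: ut_def)
  have dims: "dim_row x = n" "dim_col x = n" using xc by simp_all
  have "dagger q n (1\<^sub>m n + x) $$ (i, j) =
      ((if i = j then 1 else 0) + x $$ (opp n j, opp n i)) ^ q"
    using o e dims by (simp add: dagger_index[OF yc i j])
  also have "\<dots> = (if i = j then 1 else 0) + (x $$ (opp n j, opp n i)) ^ q"
    using z q by (cases "i = j") simp_all
  also have "\<dots> = (1\<^sub>m n + dagger q n x) $$ (i, j)"
    using i j by (simp add: dim_dagger dagger_index[OF xc i j])
  finally show "dagger q n (1\<^sub>m n + x) $$ (i, j) = (1\<^sub>m n + dagger q n x) $$ (i, j)" .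
qed (simp_all add: dim_dagger)

definition UU :: "nat \<Rightarrow> nat \<Rightarrow> 'a::field mat set" where
  "UU q n = {g \<in> carrier (UT n). inv\<^bsub>UT n\<^esub> g = dagger q n g}"

definition uu :: "nat \<Rightarrow> nat \<Rightarrow> 'a::field mat set" where
  "uu q n = {x \<in> ut n. dagger q n x = - x}"

text \<open>
  Functionals on \<open>uu q n\<close> are extensional functions, so that equality of functionals (and hence
  the size of an orbit) only depends on their values on \<open>uu q n\<close>.
\<close>

definition uu_dual :: "nat \<Rightarrow> nat \<Rightarrow> ('a::field mat \<Rightarrow> 'a) set" where
  "uu_dual q n = {l \<in> uu q n \<rightarrow>\<^sub>E Fq q.
     (\<forall>x\<in>uu q n. \<forall>y\<in>uu q n. l (x + y) = l x + l y) \<and>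
     (\<forall>c\<in>Fq q. \<forall>x\<in>uu q n. l (c \<cdot>\<^sub>m x) = c * l x)}"

definition act :: "nat \<Rightarrow> nat \<Rightarrow> 'a::field mat \<Rightarrow> 'a mat \<Rightarrow> 'a mat" where
  "act q n g x = g * x * dagger q n g"

definition act_dual ::
    "nat \<Rightarrow> nat \<Rightarrow> 'a::field mat \<Rightarrow> ('a mat \<Rightarrow> 'a) \<Rightarrow> ('a mat \<Rightarrow> 'a)" where
  "act_dual q n g l = (\<lambda>x\<in>uu q n. l (act q n (inv\<^bsub>UT n\<^esub> g) x))"

definition G_orbit :: "nat \<Rightarrow> nat \<Rightarrow> 'a::field mat \<Rightarrow> 'a mat set" where
  "G_orbit q n x = (\<lambda>g. act q n g x) ` carrier (UT n)"

definition G_orbit_dual :: "nat \<Rightarrow> nat \<Rightarrow> ('a::field mat \<Rightarrow> 'a) \<Rightarrow> ('a mat \<Rightarrow> 'a) set" where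
  "G_orbit_dual q n l = (\<lambda>g. act_dual q n g l) ` carrier (UT n)"

text \<open>With indices starting at \<open>0\<close>, the \<open>j\<close>-th column is among the first \<open>n/2\<close> iff
  \<open>j + 1 \<le> n/2\<close>.\<close>

definition hh :: "nat \<Rightarrow> 'a::field mat set" where
  "hh n = {x \<in> ut n. \<forall>i<n. \<forall>j<n. 2 * (j + 1) \<le> n \<longrightarrow> x $$ (i, j) = 0}"

definition HH :: "nat \<Rightarrow> 'a::field mat set" where
  "HH n = (\<lambda>x. 1\<^sub>m n + x) ` hh n"

definition H_orbit_dual :: "nat \<Rightarrow> nat \<Rightarrow> ('a::field mat \<Rightarrow> 'a) \<Rightarrow> ('a mat \<Rightarrow> 'a) set" where
  "H_orbit_dual q n l = (\<lambda>h. act_dual q n h l) ` HH n"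

text \<open>The power series is cut off at \<open>n\<close>, since \<open>x\<^sup>n = 0\<close> for strictly upper triangular \<open>x\<close>.\<close>

definition springer_morphism :: "nat \<Rightarrow> nat \<Rightarrow> ('a::field mat \<Rightarrow> 'a mat) \<Rightarrow> bool" where
  "springer_morphism q n f \<longleftrightarrow>
     bij_betw f (carrier (UT n)) (ut n) \<and> f ` UU q n = uu q n \<and>
     (\<exists>a :: nat \<Rightarrow> 'a. (\<forall>i. a i \<in> Fq q) \<and>
        (\<forall>x\<in>ut n. f (1\<^sub>m n + x) =
           x + mat n n (\<lambda>rc. \<Sum>i = 2..<n. a i * (x ^\<^sub>m i) $$ rc)))"

text \<open>Only the values of the function on \<open>Fq q\<close> matter.\<close>

definition nontrivial_additive_character :: "nat \<Rightarrow> ('a::field \<Rightarrow> complex) \<Rightarrow> bool" where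
  "nontrivial_additive_character q \<theta> \<longleftrightarrow>
     (\<forall>c\<in>Fq q. \<theta> c \<noteq> 0) \<and> (\<forall>c\<in>Fq q. \<forall>d\<in>Fq q. \<theta> (c + d) = \<theta> c * \<theta> d) \<and>
     (\<exists>c\<in>Fq q. \<theta> c \<noteq> 1)"

definition superclass ::
    "nat \<Rightarrow> nat \<Rightarrow> ('a::field mat \<Rightarrow> 'a mat) \<Rightarrow> 'a mat \<Rightarrow> 'a mat set" where
  "superclass q n f u = {v \<in> UU q n. f v \<in> G_orbit q n (f u)}"

definition supercharacter ::
    "nat \<Rightarrow> nat \<Rightarrow> ('a::field mat \<Rightarrow> 'a mat) \<Rightarrow> ('a \<Rightarrow> complex) \<Rightarrow> ('a mat \<Rightarrow> 'a)
      \<Rightarrow> ('a mat \<Rightarrow> complex)" where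
  "supercharacter q n f \<theta> l = (\<lambda>v\<in>UU q n.
     of_nat (card (H_orbit_dual q n l)) / of_nat (card (G_orbit_dual q n l)) *
     (\<Sum>m\<in>G_orbit_dual q n l. \<theta> (m (f v))))"

text \<open>The triple \<open>(i, a, j)\<close> is the arc from \<open>i\<close> to \<open>j\<close> with label \<open>a\<close>.\<close>

definition labeled_set_partition :: "nat \<Rightarrow> (nat \<times> 'a::field \<times> nat) set \<Rightarrow> bool" where
  "labeled_set_partition n \<eta> \<longleftrightarrow>
     (\<forall>(i, a, j)\<in>\<eta>. i < j \<and> j < n \<and> a \<noteq> 0) \<and>
     (\<forall>i a j b k. (i, a, j) \<in> \<eta> \<and> (i, b, k) \<in> \<eta> \<longrightarrow> a = b \<and> j = k) \<and>
     (\<forall>i a j b k. (i, a, j) \<in> \<eta> \<and> (k, b, j) \<in> \<eta> \<longrightarrow> a = b \<and> i = k)"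

definition twisted_set_partition ::
    "nat \<Rightarrow> nat \<Rightarrow> (nat \<times> 'a::field \<times> nat) set \<Rightarrow> bool" where
  "twisted_set_partition q n \<eta> \<longleftrightarrow> labeled_set_partition n \<eta> \<and>
     (\<forall>(i, a, j)\<in>\<eta>. (opp n j, - (a ^ q), opp n i) \<in> \<eta>)"

definition x_part :: "nat \<Rightarrow> (nat \<times> 'a::field \<times> nat) set \<Rightarrow> 'a mat" where
  "x_part n \<eta> = mat n n (\<lambda>(i, j).
     if \<exists>a. (i, a, j) \<in> \<eta> then (THE a. (i, a, j) \<in> \<eta>) else 0)"

definition u_part ::
    "nat \<Rightarrow> nat \<Rightarrow> ('a::field mat \<Rightarrow> 'a mat) \<Rightarrow> (nat \<times> 'a \<times> nat) set \<Rightarrow> 'a mat" where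
  "u_part q n f \<eta> = the_inv_into (UU q n) f (x_part n \<eta>)"

definition l_part ::
    "nat \<Rightarrow> nat \<Rightarrow> (nat \<times> 'a::field \<times> nat) set \<Rightarrow> ('a mat \<Rightarrow> 'a)" where
  "l_part q n \<eta> = (\<lambda>x\<in>uu q n. \<Sum>(i, a, j)\<in>\<eta>. a * x $$ (i, j))"

end

theory Submission
  imports Defs "Jordan_Normal_Form.Determinant" "HOL-Computational_Algebra.Polynomial"
    "HOL-Number_Theory.Residues"
begin

text \<open>
  Multiplying by the antidiagonal matrix turns \<open>x\<close> with \<open>dagger x = - x\<close> into a skew-Hermitian
  form on which unitriangular matrices act by change of basis. In odd characteristic, a unitriangular
  basis can be chosen so that the Gram matrix has at most one nonzero entry in each row and
  column, and such matrices are exactly those given by twisted set partitions. Functionals are also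
  represented by skew-Hermitian matrices, on which the group acts in the same way up to
  transposition.
\<close>

text \<open>With \<open>J\<close> the antidiagonal matrix, \<open>dagger q n g * J\<close> is
  \<open>J\<close> times the conjugate transpose of \<open>g\<close>. Hence
  \<open>act q n g x * J\<close> is the Gram matrix of the form \<open>x * J\<close> in the basis
  formed by the rows of \<open>g\<close>, and right multiplication by \<open>J\<close> only reverses
  columns, so it keeps the number of nonzero entries in each row and column. The obstacle is that a
  basis vector may be changed only by later ones, so orthogonalisation cannot choose its pivots
  freely. An isotropic vector has to be split off together with a partner, and the square of the
  partner is then removed by halving it. Division by 2 returns in the splitting of matrices into
  Hermitian and skew-Hermitian parts. Both equalities of sets rest on two facts: every orbit meets
  the representatives, and superclasses and supercharacters depend only on the orbit. For
  supercharacters the factor \<open>card (H_orbit_dual q n l)\<close> makes the second fact a matter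
  of normality of \<open>HH n\<close>.\<close>

section \<open>The finite field and its conjugation\<close>

lemma power_CARD_eq_self:
  fixes x :: "'a::{field,finite}"
  shows "x ^ CARD('a) = x"
proof (cases "x = 0")
  case False
  let ?P = "\<Prod>y\<in>UNIV - {0 :: 'a}. y"
  have "x ^ card (UNIV - {0 :: 'a}) * ?P = (\<Prod>y\<in>UNIV - {0}. x * y)"
    by (simp add: prod.distrib)
  also have "\<dots> = ?P"
    by (rule prod.reindex_bij_witness[of _ "\<lambda>y. y / x" "\<lambda>y. x * y"]) (use False in auto)
  finally have "x ^ card (UNIV - {0 :: 'a}) = 1"
    by simp
  moreover have "CARD('a) = Suc (card (UNIV - {0 :: 'a}))"
    by (simp add: card_Suc_Diff1)
  ultimately show ?thesis by (simp only: power_Suc mult_1_right)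
qed (simp add: zero_less_card_finite)

text \<open>Naming the power map \<open>cj\<close> lets the simplifier treat it as an involutive
  field automorphism instead of expanding powers.\<close>

locale conjugation =
  fixes q :: nat and cj :: "'a::{field,finite} \<Rightarrow> 'a"
  assumes cj_power: "cj c = c ^ q"
    and cj_add [simp]: "cj (c + d) = cj c + cj d"
    and cj_cj [simp]: "cj (cj c) = c"
    and two_nonzero [simp]: "(2 :: 'a) \<noteq> 0"
    and skew_unit: "\<exists>e::'a. e \<noteq> 0 \<and> cj e = - e"
begin

lemma cj_mult [simp]: "cj (c * d) = cj c * cj d"
  by (simp add: cj_power power_mult_distrib)

lemma cj_0 [simp]: "cj 0 = 0"
  using cj_add[of 0 0] by (metis add_cancel_right_right add_0)

lemma cj_1 [simp]: "cj 1 = 1"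
  by (simp add: cj_power)

lemma cj_uminus [simp]: "cj (- c) = - cj c"
  by (metis cj_0 cj_add add_eq_0_iff add.right_inverse)

lemma cj_diff [simp]: "cj (c - d) = cj c - cj d"
  by (metis cj_add cj_uminus diff_conv_add_uminus)

lemma cj_inverse [simp]: "cj (inverse c) = inverse (cj c)"
  by (simp add: cj_power power_inverse)

lemma cj_divide [simp]: "cj (c / d) = cj c / cj d"
  by (simp add: divide_inverse)

lemma cj_eq_0_iff [simp]: "cj c = 0 \<longleftrightarrow> c = 0"
  by (metis cj_0 cj_cj)

lemma cj_numeral_2 [simp]: "cj 2 = 2"
  by (metis cj_1 cj_add one_add_one)

lemma cj_sum: "cj (sum f A) = (\<Sum>x\<in>A. cj (f x))"
  by (induction A rule: infinite_finite_induct) simp_all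

lemma mem_Fq: "c \<in> Fq q \<longleftrightarrow> cj c = c"
  by (simp add: Fq_def cj_power)

end

text \<open>The characteristic divides the number of elements, a power of \<open>p\<close>, so it is
  \<open>p\<close> and the power map is additive. A skew element is \<open>c - c ^ q\<close> for any
  \<open>c\<close> outside the fixed field.\<close>

lemma conjugation_power:
  assumes "prime p" "odd p" "k \<ge> 1" "q = p ^ k" "CARD('a::{field,finite}) = q ^ 2"
  shows "conjugation q (\<lambda>c::'a. c ^ q)"
proof
  have char: "prime CHAR('a)"
    using finite_imp_CHAR_pos[where ?'a = 'a] by (intro prime_CHAR_semidom) simp
  have "CHAR('a) dvd p ^ (k * 2)"
    using CHAR_dvd_CARD[where ?'a = 'a] assms(4,5) by (simp add: power_mult)
  then have p: "CHAR('a) = p"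
    using char assms(1) prime_dvd_power primes_dvd_imp_eq by blast
  show "(c + d) ^ q = c ^ q + d ^ q" for c d :: 'a
    using char by (intro freshmans_dream') (simp_all add: p assms(4))
  show "(c ^ q) ^ q = c" for c :: 'a
    using power_CARD_eq_self[of c] assms(5) by (simp add: power_mult power2_eq_square)
  show "(2 :: 'a) \<noteq> 0"
  proof
    assume "(2 :: 'a) = 0"
    then have "of_nat 2 = (0 :: 'a)" by simp
    then have "p dvd 2" using p of_nat_eq_0_iff_char_dvd by metis
    then show False using assms(1,2) by (metis primes_dvd_imp_eq two_is_prime_nat even_numeral)
  qed
  have q1: "q > 1" 
    unfolding assms(4) using assms(3) by (intro one_less_power prime_gt_1_nat[OF assms(1)]) simp
  have "\<exists>c::'a. c ^ q \<noteq> c"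
  proof (rule ccontr)
    \<comment> \<open>Fixed elements are roots of X^q - X, which has at most q of them, fewer than
      the q^2 elements of the field.\<close>
    define P :: "'a poly" where "P = Polynomial.monom 1 q - Polynomial.monom 1 1"
    assume "\<not> ?thesis"
    then have all: "{x. poly P x = 0} = UNIV" by (simp add: P_def poly_monom)
    have "poly.coeff P q = 1" using q1 by (simp add: P_def)
    then have "P \<noteq> 0" by auto
    then have "CARD('a) \<le> Polynomial.degree P" using card_poly_roots_bound[of P] all by simp
    also have "Polynomial.degree P \<le> q"
      unfolding P_def using q1 by (intro degree_diff_le) (simp_all add: degree_monom_eq)
    finally show False using q1 assms(5) by (simp add: power2_eq_square)
  qed
  then obtain c :: 'a where c: "c ^ q \<noteq> c" by blast
  have odd: "odd q" using assms(2,4) by simp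
  have "(c - c ^ q) ^ q = c ^ q + (- (c ^ q)) ^ q"
    using \<open>\<And>c d::'a. (c + d) ^ q = c ^ q + d ^ q\<close>[of c "- (c ^ q)"] by simp
  also have "\<dots> = - (c - c ^ q)"
    using odd \<open>(c ^ q) ^ q = c\<close> by simp
  finally show "\<exists>e::'a. e \<noteq> 0 \<and> e ^ q = - e"
    using c by (intro exI[of _ "c - c ^ q"]) simp
qed (rule refl)

section \<open>Monomial Gram matrices of skew-Hermitian forms\<close>

context conjugation
begin

text \<open>
  \<open>R\<close> is the set of indices not yet dealt with. Take the row of its maximum \<open>r\<close> and the last
  nonzero entry of this row, in column \<open>j\<close>: the vectors at \<open>r\<close> and \<open>j\<close> span a nondegenerate
  subspace, and the remaining vectors are projected to its orthogonal complement. By the choice of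
  \<open>r\<close> and \<open>j\<close>, this only adds later vectors to earlier ones.
\<close>

lemma monomial_Gram_matrix:
  fixes S :: "(nat \<Rightarrow> 'a) \<Rightarrow> (nat \<Rightarrow> 'a) \<Rightarrow> 'a" and n :: nat
  assumes lin: "\<And>c u v w. S (\<lambda>a. u a + c * v a) w = S u w + c * S v w"
    and skew: "\<And>u v. S v u = - cj (S u v)"
  shows "\<exists>v. (\<forall>i<n. v i i = 1 \<and> (\<forall>a<i. v i a = 0)) \<and>
    (\<forall>i<n. \<forall>j<n. \<forall>k<n. S (v i) (v j) \<noteq> 0 \<longrightarrow> S (v i) (v k) \<noteq> 0 \<longrightarrow> j = k)"
proof -
  have rlin: "S w (\<lambda>a. u a + c * v a) = S w u + cj c * S w v" for c u v w
    using lin[of u c v w] skew[of w u] skew[of w v] skew[of w "\<lambda>a. u a + c * v a"] by simp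
  \<comment> \<open>Generalised for the induction: the rows outside \<open>R\<close> are already
    monomial, and the vectors outside \<open>R\<close> are orthogonal to those in
    \<open>R\<close>.\<close>
  have "\<exists>v. (\<forall>i<n. v i i = 1 \<and> (\<forall>a<i. v i a = 0)) \<and>
      (\<forall>i<n. \<forall>j<n. \<forall>k<n. S (v i) (v j) \<noteq> 0 \<longrightarrow> S (v i) (v k) \<noteq> 0 \<longrightarrow> j = k)"
    if "R \<subseteq> {..<n}" "\<forall>i<n. v i i = 1 \<and> (\<forall>a<i. v i a = 0)"
      "\<forall>i\<in>{..<n} - R. \<forall>j<n. \<forall>k<n. S (v i) (v j) \<noteq> 0 \<longrightarrow> S (v i) (v k) \<noteq> 0 \<longrightarrow> j = k"
      "\<forall>i\<in>{..<n} - R. \<forall>j\<in>R. S (v i) (v j) = 0"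
    for R v
    using that
  proof (induction "card R" arbitrary: R v rule: less_induct)
    case less
    note flag = less.prems(2) and mono = less.prems(3) and orth = less.prems(4)
    have fin: "finite R" using less.prems(1) finite_subset by blast
    show ?case
    proof (cases "R = {}")
      case True
      then show ?thesis using less.prems by (intro exI[of _ v]) auto
    next
      case False
      define r where "r = Max R"
      have r: "r \<in> R" "\<And>i. i \<in> R \<Longrightarrow> i \<le> r" using False fin by (simp_all add: r_def)
      then have rn: "r < n" using less.prems(1) by auto
      have orth': "S (v j) (v i) = 0" if "i < n" "i \<notin> R" "j \<in> R" for i j
        using orth skew[of "v j" "v i"] that by auto
      have card_less: "card (R - T) < card R" if "r \<in> T" for T
        using that r fin by (intro psubset_card_mono) auto
      show ?thesis
      \<comment> \<open>The first case splits off \<open>v r\<close> alone: either it is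
        anisotropic, or it is already orthogonal to all of \<open>R\<close>.\<close>
      proof (cases "S (v r) (v r) = 0 \<and> (\<exists>j\<in>R. S (v r) (v j) \<noteq> 0)")
        case False
        \<comment> \<open>If \<open>S (v r) (v r) = 0\<close>, division by zero gives
          \<open>al i = 0\<close>, and nothing is changed.\<close>
        define al where "al i = - (S (v i) (v r) / S (v r) (v r))" for i
        define v' where "v' i = (if i \<in> R - {r} then (\<lambda>a. v i a + al i * v r a) else v i)" for i
        have v'_orth: "S (v' i) (v r) = 0" if "i \<in> R - {r}" for i
        proof (cases "S (v r) (v r) = 0")
          case True
          then have "S (v r) (v i) = 0" using False that by auto
          then have "S (v i) (v r) = 0" using skew[of "v i" "v r"] by simp
          then show ?thesis using that True by (simp add: v'_def lin)
        next
          case False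
          have "S (v' i) (v r) = S (v i) (v r) + al i * S (v r) (v r)"
            using that by (simp add: v'_def lin)
          then show ?thesis using False by (simp add: al_def)
        qed
        have v'_orth': "S (v r) (v' i) = 0" if "i \<in> R - {r}" for i
          using v'_orth[OF that] skew[of "v r" "v' i"] by simp
        have out: "S (v' i) (v' j) = S (v i) (v j)" if "i < n" "i \<notin> R" "j < n" for i j
          using that orth r(1) by (auto simp: v'_def rlin)
        have v'_r: "v' r = v r" by (simp add: v'_def)
        have row_r: "S (v' r) (v' j) = 0" if "j < n" "j \<noteq> r" for j
        proof (cases "j \<in> R")
          case True
          then show ?thesis using that v'_orth'[of j] by (simp add: v'_r)
        next
          case False
          then have "v' j = v j" by (simp add: v'_def)
          then show ?thesis using that False orth'[of j r] r(1) by (simp add: v'_r)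
        qed
        show ?thesis
        proof (rule less.hyps[of "R - {r}" v'])
          show "card (R - {r}) < card R" by (rule card_less) simp
          show "R - {r} \<subseteq> {..<n}" using less.prems(1) by auto
          show "\<forall>i<n. v' i i = 1 \<and> (\<forall>a<i. v' i a = 0)"
          proof (intro allI impI)
            fix i assume i: "i < n"
            show "v' i i = 1 \<and> (\<forall>a<i. v' i a = 0)"
            proof (cases "i \<in> R - {r}")
              case True
              then have "i < r" using r(2)[of i] by auto
              then show ?thesis using True flag i rn by (auto simp: v'_def)
            next
              case False
              then show ?thesis using flag i by (auto simp: v'_def)
            qed
          qed
          show "\<forall>i\<in>{..<n} - (R - {r}). \<forall>j<n. \<forall>k<n.
              S (v' i) (v' j) \<noteq> 0 \<longrightarrow> S (v' i) (v' k) \<noteq> 0 \<longrightarrow> j = k"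
          proof (intro ballI allI impI)
            fix i j k assume *: "i \<in> {..<n} - (R - {r})" "j < n" "k < n"
              "S (v' i) (v' j) \<noteq> 0" "S (v' i) (v' k) \<noteq> 0"
            show "j = k"
            proof (cases "i = r")
              case True
              then show ?thesis using * row_r by metis
            next
              case False
              then show ?thesis using * mono by (auto simp: out)
            qed
          qed
          show "\<forall>i\<in>{..<n} - (R - {r}). \<forall>j\<in>R - {r}. S (v' i) (v' j) = 0"
          proof (intro ballI)
            fix i j assume *: "i \<in> {..<n} - (R - {r})" "j \<in> R - {r}"
            then have "j < n" using less.prems(1) by auto
            then show "S (v' i) (v' j) = 0"
              using * row_r[of j] out[of i j] orth by (cases "i = r") auto
          qed
        qed
      next
        case True
        define j where "j = Max {j\<in>R. S (v r) (v j) \<noteq> 0}"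
        have "j \<in> {j\<in>R. S (v r) (v j) \<noteq> 0}"
          unfolding j_def using True fin by (intro Max_in) auto
        then have j: "j \<in> R" "S (v r) (v j) \<noteq> 0" by auto
        have jmax: "i \<le> j" if "i \<in> R" "S (v r) (v i) \<noteq> 0" for i
          unfolding j_def using that fin by (intro Max_ge) auto
        have rr: "S (v r) (v r) = 0" using True by simp
        have "j \<noteq> r" using j(2) rr by auto
        then have jr: "j < r" using r(2)[OF j(1)] by simp
        have jn: "j < n" using jr rn by simp
        define p where "p = S (v r) (v j)"
        have p: "p \<noteq> 0" using j(2) by (simp add: p_def)
        \<comment> \<open>As \<open>S (v j) (v j)\<close> is skew, each of the two cross terms in
          \<open>S w w\<close> contributes minus half of it. So \<open>w\<close> is isotropic, and
          \<open>v r\<close>, \<open>w\<close> form a hyperbolic pair.\<close>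
        define c where "c = - (S (v j) (v j) / (2 * p))"
        define w where "w = (\<lambda>a. v j a + c * v r a)"
        have jr_p: "S (v j) (v r) = - cj p" using skew[of "v j" "v r"] by (simp add: p_def)
        have cjj: "cj (S (v j) (v j)) = - S (v j) (v j)"
          using skew[of "v j" "v j"] by (metis minus_minus)
        have wr: "S w (v r) = - cj p" by (simp add: w_def lin jr_p rr)
        have rw: "S (v r) w = p" by (simp add: w_def rlin rr p_def)
        have ww: "S w w = 0"
        proof -
          define s where "s = S (v j) (v j)"
          have cs: "cj s = - s" using cjj by (simp add: s_def)
          have "S w w = s + cj c * S (v j) (v r) + c * S (v r) (v j)"
            by (simp add: w_def lin rlin rr s_def)
          also have "cj c * S (v j) (v r) = - (s / 2)"
            using p by (simp add: jr_p c_def cs s_def[symmetric])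
          also have "c * S (v r) (v j) = - (s / 2)"
            using p by (simp add: c_def s_def[symmetric] p_def[symmetric])
          also have "s + - (s / 2) + - (s / 2) = s - (s + s) / 2"
            by (simp only: add_divide_distrib) simp
          also have "\<dots> = 0" by (simp add: mult_2[symmetric])
          finally show ?thesis .
        qed
        \<comment> \<open>Since \<open>v r\<close> and \<open>w\<close> are isotropic, the
          conditions of orthogonality to them decouple: \<open>be\<close> settles the one for
          \<open>v r\<close>, \<open>al\<close> the one for \<open>w\<close>.\<close>
        define al where "al i = - (S (v i) w / p)" for i
        define be where "be i = S (v i) (v r) / cj p" for i
        define v' where "v' i = (if i = j then w else if i \<in> R - {r, j}
          then (\<lambda>a. (v i a + al i * v r a) + be i * w a) else v i)" for i
        have orth_r: "S (v' i) (v r) = 0" and orth_w: "S (v' i) w = 0" if "i \<in> R - {r, j}" for i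
        proof -
          have "v' i = (\<lambda>a. (v i a + al i * v r a) + be i * w a)"
            using that by (simp add: v'_def)
          then have "S (v' i) (v r) = S (v i) (v r) + al i * S (v r) (v r) + be i * S w (v r)"
            "S (v' i) w = S (v i) w + al i * S (v r) w + be i * S w w"
            by (simp_all only: lin)
          then show "S (v' i) (v r) = 0" "S (v' i) w = 0"
            using p by (simp_all add: rr wr rw ww al_def be_def)
        qed
        have v'_r: "v' r = v r" and v'_j: "v' j = w"
          using \<open>j \<noteq> r\<close> by (simp_all add: v'_def)
        have out: "S (v' i) (v' l) = S (v i) (v l)" if "i < n" "i \<notin> R" "l < n" for i l
        proof -
          have "S (v i) (v r) = 0" "S (v i) (v j) = 0" using that orth r(1) j(1) by auto
          moreover have "v' i = v i" using that j(1) by (auto simp: v'_def)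
          ultimately show ?thesis by (auto simp: v'_def rlin w_def)
        qed
        have row_r: "S (v' r) (v' l) = 0" and row_j: "S (v' j) (v' l) = 0"
          if l: "l < n" "l \<notin> {r, j}" for l
        proof -
          have "S (v' l) (v r) = 0 \<and> S (v' l) w = 0"
          proof (cases "l \<in> R")
            case True
            then show ?thesis using orth_r orth_w l by simp
          next
            case False
            then have "S (v' l) (v' r) = 0" "S (v' l) (v' j) = 0"
              using out[of l] l rn jn orth r(1) j(1) by auto
            then show ?thesis by (simp add: v'_r v'_j)
          qed
          then show "S (v' r) (v' l) = 0" "S (v' j) (v' l) = 0"
            using skew[of "v r" "v' l"] skew[of w "v' l"] by (simp_all add: v'_r v'_j)
        qed
        show ?thesis
        proof (rule less.hyps[of "R - {r, j}" v'])
          show "card (R - {r, j}) < card R" by (rule card_less) simp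
          show "R - {r, j} \<subseteq> {..<n}" using less.prems(1) by auto
          have w_flag: "w j = 1 \<and> (\<forall>a<j. w a = 0)"
            using flag jr jn rn by (auto simp: w_def)
          show "\<forall>i<n. v' i i = 1 \<and> (\<forall>a<i. v' i a = 0)"
          proof (intro allI impI)
            fix i assume i: "i < n"
            show "v' i i = 1 \<and> (\<forall>a<i. v' i a = 0)"
            proof (cases "i \<in> R - {r, j}")
              case True
              then have ir: "i < r" using r(2)[of i] by auto
              \<comment> \<open>This is where the choice of the last column matters:
                \<open>w\<close> starts at index \<open>j\<close>, so it may be added to
                \<open>v i\<close> only if \<open>i < j\<close>; for later \<open>i\<close> the
                coefficient vanishes.\<close>
              have "be i = 0 \<or> i < j"
              proof (cases "S (v r) (v i) = 0")
                case True
                then show ?thesis using skew[of "v i" "v r"] by (simp add: be_def)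
              next
                case False
                then show ?thesis using jmax[of i] \<open>i \<in> R - {r, j}\<close> by auto
              qed
              then show ?thesis using True flag i rn ir w_flag by (auto simp: v'_def)
            next
              case False
              then show ?thesis using flag i w_flag by (auto simp: v'_def)
            qed
          qed
          show "\<forall>i\<in>{..<n} - (R - {r, j}). \<forall>l<n. \<forall>k<n.
              S (v' i) (v' l) \<noteq> 0 \<longrightarrow> S (v' i) (v' k) \<noteq> 0 \<longrightarrow> l = k"
          proof (intro ballI allI impI)
            fix i l k assume *: "i \<in> {..<n} - (R - {r, j})" "l < n" "k < n"
              "S (v' i) (v' l) \<noteq> 0" "S (v' i) (v' k) \<noteq> 0"
            consider "i = r" | "i = j" | "i \<notin> R" using * by auto
            then show "l = k"
            proof cases
              case 1
              have "m = j" if "m < n" "S (v' i) (v' m) \<noteq> 0" for m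
              proof (rule ccontr)
                assume "m \<noteq> j"
                then show False
                  using that row_r[of m] rr v'_r by (cases "m = r") (simp_all add: 1)
              qed
              then show ?thesis using * by metis
            next
              case 2
              have "m = r" if "m < n" "S (v' i) (v' m) \<noteq> 0" for m
              proof (rule ccontr)
                assume "m \<noteq> r"
                then show False
                  using that row_j[of m] ww v'_j by (cases "m = j") (simp_all add: 2)
              qed
              then show ?thesis using * by metis
            next
              case 3
              then show ?thesis using * mono by (auto simp: out)
            qed
          qed
          show "\<forall>i\<in>{..<n} - (R - {r, j}). \<forall>l\<in>R - {r, j}. S (v' i) (v' l) = 0"
          proof (intro ballI)
            fix i l assume *: "i \<in> {..<n} - (R - {r, j})" "l \<in> R - {r, j}"
            then have "l < n" using less.prems(1) by auto
            then show "S (v' i) (v' l) = 0"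
              using * row_r[of l] row_j[of l] out[of i l] orth
              by (cases "i = r"; cases "i = j") auto
          qed
        qed
      qed
    qed
  qed
  \<comment> \<open>The start is the standard basis, with all indices still in
    \<open>R\<close>.\<close>
  from this[of "{..<n}" "\<lambda>i a. if a = i then 1 else 0"] show ?thesis by simp
qed

end

section \<open>The unitriangular group and its normal subgroup \<open>HH n\<close>\<close>

lemma index_mult_sum:
  assumes "A \<in> carrier_mat n n" "B \<in> carrier_mat n n" "i < n" "j < n"
  shows "(A * B) $$ (i, j) = (\<Sum>k<n. A $$ (i, k) * B $$ (k, j))"
  using assms by (simp add: scalar_prod_def lessThan_atLeast0)

lemma mem_UT: "g \<in> carrier (UT n) \<longleftrightarrow>
    g \<in> carrier_mat n n \<and> (\<forall>i<n. g $$ (i, i) = 1 \<and> (\<forall>a<i. g $$ (i, a) = 0))"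
  by (auto simp: UT_def)

lemma UT_carrier_mat: "g \<in> carrier (UT n) \<Longrightarrow> g \<in> carrier_mat n n"
  by (simp add: mem_UT)

lemma UT_mult: "mult (UT n) = (*)" and UT_one: "one (UT n) = 1\<^sub>m n"
  by (simp_all add: UT_def)

lemma mult_mem_UT:
  assumes "g \<in> carrier (UT n)" "h \<in> carrier (UT n)"
  shows "g * h \<in> carrier (UT n)"
proof -
  have c: "g \<in> carrier_mat n n" "h \<in> carrier_mat n n" using assms by (simp_all add: mem_UT)
  have "(g * h) $$ (i, j) = 0" if "i < n" "j < i" for i j
    using that assms unfolding index_mult_sum[OF c \<open>i < n\<close> less_trans[OF that(2,1)]]
    by (intro sum.neutral) (metis lessThan_iff linorder_neqE_nat mem_UT mult_zero_left
        mult_zero_right order.strict_trans1 less_imp_le)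
  moreover have "(g * h) $$ (i, i) = 1" if "i < n" for i
  proof -
    have "(g * h) $$ (i, i) = (\<Sum>k<n. if k = i then 1 else 0)"
      unfolding index_mult_sum[OF c that that]
    proof (intro sum.cong refl)
      fix k assume "k \<in> {..<n}"
      then show "g $$ (i, k) * h $$ (k, i) = (if k = i then 1 else 0)"
        using assms that by (cases k i rule: linorder_cases) (auto simp: mem_UT)
    qed
    then show ?thesis using that by simp
  qed
  ultimately show ?thesis using c by (simp add: mem_UT)
qed

lemma one_mem_UT: "1\<^sub>m n \<in> carrier (UT n)"
  by (simp add: mem_UT)

lemma finite_carrier_mat: "finite (carrier_mat n m :: 'a::finite mat set)"
proof (rule finite_subset)
  show "carrier_mat n m \<subseteq> (\<lambda>f. mat n m f) ` (({..<n} \<times> {..<m}) \<rightarrow>\<^sub>E (UNIV :: 'a set))"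
  proof
    fix A :: "'a mat" assume "A \<in> carrier_mat n m"
    then have "A = mat n m (restrict (\<lambda>ij. A $$ ij) ({..<n} \<times> {..<m}))"
      by (intro eq_matI) auto
    moreover have "restrict (\<lambda>ij. A $$ ij) ({..<n} \<times> {..<m}) \<in> ({..<n} \<times> {..<m}) \<rightarrow>\<^sub>E UNIV"
      by simp
    ultimately show "A \<in> (\<lambda>f. mat n m f) ` (({..<n} \<times> {..<m}) \<rightarrow>\<^sub>E (UNIV :: 'a set))"
      by blast
  qed
qed (simp add: finite_PiE)

text \<open>Over a finite field, right multiplication is injective on the finite set of unitriangular
  matrices, hence surjective; so the inverse is again unitriangular.\<close>

lemma group_UT: "group (UT n :: 'a::{field,finite} mat monoid)"
proof (rule groupI; unfold UT_mult UT_one)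
  fix g h k :: "'a mat"
  assume "g \<in> carrier (UT n)" "h \<in> carrier (UT n)" "k \<in> carrier (UT n)"
  then show "g * h * k = g * (h * k)"
    by (meson UT_carrier_mat assoc_mult_mat)
next
  fix g :: "'a mat" assume g: "g \<in> carrier (UT n)"
  then have gc: "g \<in> carrier_mat n n" by (rule UT_carrier_mat)
  have "upper_triangular g" using g by (simp add: UT_def)
  then have "det g = prod_list (diag_mat g)" by (rule det_upper_triangular[OF _ gc])
  also have "\<dots> = 1"
  proof -
    have "prod_list xs = 1" if "\<forall>x\<in>set xs. x = 1" for xs :: "'a list"
      using that by (induction xs) auto
    then show ?thesis using g gc by (auto simp: mem_UT diag_mat_def)
  qed
  \<comment> \<open>Nothing is known yet about the shape of \<open>b\<close>; it serves only to
    cancel \<open>g\<close> on the right.\<close>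
  finally obtain b where b: "b \<in> carrier_mat n n" "g * b = 1\<^sub>m n"
    using det_non_zero_imp_unit[OF gc, of "()"] by (auto simp: Units_def ring_mat_simps)
  let ?R = "\<lambda>y. y * g"
  have "inj_on ?R (carrier (UT n))"
  proof (rule inj_onI)
    fix y z assume y: "y \<in> carrier (UT n)" and z: "z \<in> carrier (UT n)" and eq: "y * g = z * g"
    have "w = (w * g) * b" if "w \<in> carrier (UT n)" for w
      using UT_carrier_mat[OF that] gc b by (simp add: assoc_mult_mat[of w n n g n b n])
    then show "y = z" using y z eq by metis
  qed
  moreover have "finite (carrier (UT n) :: 'a mat set)"
    by (rule finite_subset[OF _ finite_carrier_mat[of n n]]) (auto simp: mem_UT)
  moreover have "?R ` carrier (UT n) \<subseteq> carrier (UT n)"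
    using g by (auto intro: mult_mem_UT)
  ultimately have "?R ` carrier (UT n) = carrier (UT n)"
    by (intro endo_inj_surj)
  then show "\<exists>y\<in>carrier (UT n). y * g = 1\<^sub>m n"
    using one_mem_UT by (metis (no_types, lifting) imageE)
qed (simp_all add: mult_mem_UT one_mem_UT UT_carrier_mat left_mult_one_mat[OF UT_carrier_mat])

lemma UT_inv:
  fixes g :: "'a::{field,finite} mat"
  assumes "g \<in> carrier (UT n)"
  shows "inv\<^bsub>UT n\<^esub> g \<in> carrier (UT n)" "inv\<^bsub>UT n\<^esub> g * g = 1\<^sub>m n" "g * inv\<^bsub>UT n\<^esub> g = 1\<^sub>m n"
  using group.inv_closed[OF group_UT assms] group.l_inv[OF group_UT assms]
    group.r_inv[OF group_UT assms]
  by (simp_all add: UT_mult UT_one)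

lemma mem_ut: "x \<in> ut n \<longleftrightarrow> x \<in> carrier_mat n n \<and> (\<forall>i<n. \<forall>j\<le>i. x $$ (i, j) = 0)"
  by (simp add: ut_def)

lemma UT_mult_ut:
  assumes "g \<in> carrier (UT n)" "x \<in> ut n"
  shows "g * x \<in> ut n"
proof -
  have c: "g \<in> carrier_mat n n" "x \<in> carrier_mat n n" using assms by (simp_all add: mem_UT mem_ut)
  have "(g * x) $$ (i, j) = 0" if "i < n" "j \<le> i" for i j
    unfolding index_mult_sum[OF c that(1) le_less_trans[OF that(2,1)]]
  proof (intro sum.neutral ballI)
    fix k assume "k \<in> {..<n}"
    then show "g $$ (i, k) * x $$ (k, j) = 0"
      using that assms by (cases "k < i") (auto simp: mem_UT mem_ut)
  qed
  then show ?thesis using c by (simp add: mem_ut)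
qed

lemma ut_mult_UT:
  assumes "g \<in> carrier (UT n)" "x \<in> ut n"
  shows "x * g \<in> ut n"
proof -
  have c: "g \<in> carrier_mat n n" "x \<in> carrier_mat n n" using assms by (simp_all add: mem_UT mem_ut)
  have "(x * g) $$ (i, j) = 0" if "i < n" "j \<le> i" for i j
    unfolding index_mult_sum[OF c(2,1) that(1) le_less_trans[OF that(2,1)]]
  proof (intro sum.neutral ballI)
    fix k assume "k \<in> {..<n}"
    then show "x $$ (i, k) * g $$ (k, j) = 0"
      using that assms by (cases "k \<le> i") (auto simp: mem_UT mem_ut)
  qed
  then show ?thesis using c by (simp add: mem_ut)
qed

text \<open>Left multiplication mixes rows, so vanishing columns stay zero. With
  \<open>hh_mult_UT\<close> this makes \<open>hh n\<close> stable on both sides, which yields the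
  normality of \<open>HH n\<close>.\<close>

lemma UT_mult_hh:
  assumes "g \<in> carrier (UT n)" "x \<in> hh n"
  shows "g * x \<in> hh n"
proof -
  have c: "g \<in> carrier_mat n n" "x \<in> carrier_mat n n"
    using assms by (simp_all add: mem_UT mem_ut hh_def)
  have "(g * x) $$ (i, j) = 0" if "i < n" "j < n" "2 * (j + 1) \<le> n" for i j
    unfolding index_mult_sum[OF c that(1,2)]
    using that assms by (intro sum.neutral) (auto simp: hh_def)
  then show ?thesis using assms UT_mult_ut by (auto simp: hh_def)
qed

text \<open>Column \<open>j\<close> of \<open>x * g\<close> involves only the columns
  \<open>k \<le> j\<close> of \<open>x\<close>, and these vanish whenever column \<open>j\<close> is
  in the left half.\<close>

lemma hh_mult_UT:
  assumes "g \<in> carrier (UT n)" "x \<in> hh n"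
  shows "x * g \<in> hh n"
proof -
  have c: "g \<in> carrier_mat n n" "x \<in> carrier_mat n n"
    using assms by (simp_all add: mem_UT mem_ut hh_def)
  have "(x * g) $$ (i, j) = 0" if "i < n" "j < n" "2 * (j + 1) \<le> n" for i j
    unfolding index_mult_sum[OF c(2,1) that(1,2)]
  proof (intro sum.neutral ballI)
    fix k assume "k \<in> {..<n}"
    then show "x $$ (i, k) * g $$ (k, j) = 0"
      using that assms by (cases "k \<le> j") (auto simp: mem_UT hh_def)
  qed
  then show ?thesis using assms ut_mult_UT by (auto simp: hh_def)
qed

lemma HH_subset_UT: "HH n \<subseteq> carrier (UT n)"
  by (auto simp: HH_def hh_def mem_ut mem_UT)

lemma conj_mem_HH:
  fixes g :: "'a::{field,finite} mat"
  assumes g: "g \<in> carrier (UT n)" and h: "h \<in> HH n"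
  shows "inv\<^bsub>UT n\<^esub> g * h * g \<in> HH n"
proof -
  let ?i = "inv\<^bsub>UT n\<^esub> g"
  obtain x where x: "x \<in> hh n" "h = 1\<^sub>m n + x" using h by (auto simp: HH_def)
  have c: "g \<in> carrier_mat n n" "?i \<in> carrier_mat n n" "x \<in> carrier_mat n n"
    using UT_carrier_mat[OF g] UT_carrier_mat[OF UT_inv(1)[OF g]] x(1)
    by (simp_all add: hh_def mem_ut)
  have "?i * h * g = ?i * g + ?i * x * g"
    using c by (simp add: x(2) mult_add_distrib_mat[of _ n n _ n] add_mult_distrib_mat[of _ n n _ _ n])
  also have "\<dots> = 1\<^sub>m n + ?i * x * g" by (simp add: UT_inv(2)[OF g])
  finally show ?thesis
    using hh_mult_UT[OF g UT_mult_hh[OF UT_inv(1)[OF g] x(1)]] by (simp add: HH_def)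
qed

section \<open>Skew-Hermitian matrices and the action\<close>

lemma opp_less [simp]: "i < n \<Longrightarrow> opp n i < n"
  by (simp add: opp_def)

lemma opp_opp [simp]: "i < n \<Longrightarrow> opp n (opp n i) = i"
  by (simp add: opp_def)

lemma opp_less_opp_iff: "i < n \<Longrightarrow> j < n \<Longrightarrow> opp n i < opp n j \<longleftrightarrow> j < i"
  unfolding opp_def by linarith

lemma opp_inject [simp]: "i < n \<Longrightarrow> j < n \<Longrightarrow> opp n i = opp n j \<longleftrightarrow> i = j"
  unfolding opp_def by linarith

lemma sum_opp: "(\<Sum>k<n. f (opp n k)) = (\<Sum>k<n. f k)"
  by (rule sum.reindex_bij_witness[of _ "opp n" "opp n"]) auto

text \<open>Unlike in the usual notion, zero rows and columns are allowed, as an index need not be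
  an endpoint of an arc.\<close>

definition monomial_mat :: "nat \<Rightarrow> 'a::zero mat \<Rightarrow> bool" where
  "monomial_mat n y \<longleftrightarrow>
     (\<forall>i<n. \<forall>j<n. \<forall>k<n. y $$ (i, j) \<noteq> 0 \<longrightarrow> y $$ (i, k) \<noteq> 0 \<longrightarrow> j = k) \<and>
     (\<forall>i<n. \<forall>j<n. \<forall>k<n. y $$ (j, i) \<noteq> 0 \<longrightarrow> y $$ (k, i) \<noteq> 0 \<longrightarrow> j = k)"

context conjugation
begin

lemma dagger_carrier_mat [simp]: "dagger q n x \<in> carrier_mat n n"
  by (intro carrier_matI) (simp_all add: dim_dagger)

lemma index_dagger:
  assumes "x \<in> carrier_mat n n" "i < n" "j < n"
  shows "dagger q n x $$ (i, j) = cj (x $$ (opp n j, opp n i))"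
  using dagger_index[OF assms] by (simp add: cj_power)

lemma dagger_dagger:
  fixes x :: "'a mat"
  assumes "x \<in> carrier_mat n n"
  shows "dagger q n (dagger q n x) = x"
  using assms by (intro eq_matI) (auto simp: index_dagger dim_dagger)

lemma dagger_mult:
  fixes a b :: "'a mat"
  assumes a: "a \<in> carrier_mat n n" and b: "b \<in> carrier_mat n n"
  shows "dagger q n (a * b) = dagger q n b * dagger q n a"
proof (rule eq_matI)
  fix i j assume "i < dim_row (dagger q n b * dagger q n a)" "j < dim_col (dagger q n b * dagger q n a)"
  then have ij: "i < n" "j < n" by (simp_all add: dim_dagger)
  have "dagger q n (a * b) $$ (i, j) = (\<Sum>k<n. cj (a $$ (opp n j, k)) * cj (b $$ (k, opp n i)))"
    using a b ij by (simp add: index_dagger index_mult_sum cj_sum del: index_mult_mat)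
  also have "\<dots> = (\<Sum>k<n. cj (a $$ (opp n j, opp n k)) * cj (b $$ (opp n k, opp n i)))"
    by (rule sum_opp[symmetric])
  also have "\<dots> = (dagger q n b * dagger q n a) $$ (i, j)"
    using a b ij by (simp add: index_dagger index_mult_sum[where n = n] ac_simps del: index_mult_mat)
  finally show "dagger q n (a * b) $$ (i, j) = (dagger q n b * dagger q n a) $$ (i, j)" .
qed (simp_all add: dim_dagger)

lemma dagger_mem_UT:
  fixes g :: "'a mat"
  assumes "g \<in> carrier (UT n)"
  shows "dagger q n g \<in> carrier (UT n)"
  using assms by (auto simp: mem_UT index_dagger opp_less_opp_iff)

lemma dagger_one [simp]: "dagger q n (1\<^sub>m n :: 'a mat) = 1\<^sub>m n"
  by (intro eq_matI) (auto simp: index_dagger dim_dagger)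

text \<open>This entrywise form is the condition on arcs of a twisted set partition: reflect the
  position, conjugate and negate the label.\<close>

lemma dagger_eq_uminus_iff:
  assumes "x \<in> carrier_mat n n"
  shows "dagger q n x = - x \<longleftrightarrow>
    (\<forall>i<n. \<forall>j<n. x $$ (opp n j, opp n i) = - cj (x $$ (i, j)))"
proof
  assume "dagger q n x = - x"
  then have "dagger q n x $$ (opp n j, opp n i) = (- x) $$ (opp n j, opp n i)" for i j by simp
  then have "cj (x $$ (i, j)) = - x $$ (opp n j, opp n i)" if "i < n" "j < n" for i j
    using assms that index_dagger[OF assms, of "opp n j" "opp n i"] by (metis (no_types, lifting)
      carrier_matD index_uminus_mat(1) opp_less opp_opp)
  then show "\<forall>i<n. \<forall>j<n. x $$ (opp n j, opp n i) = - cj (x $$ (i, j))"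
    by simp
next
  assume *: "\<forall>i<n. \<forall>j<n. x $$ (opp n j, opp n i) = - cj (x $$ (i, j))"
  show "dagger q n x = - x"
    using assms * by (intro eq_matI) (auto simp: index_dagger dim_dagger)
qed

lemma act_carrier_mat [simp]:
  "g \<in> carrier_mat n n \<Longrightarrow> act q n g x \<in> carrier_mat n n"
  by (rule carrier_matI) (auto simp: act_def dim_dagger)

lemma act_mult:
  fixes g h x :: "'a mat"
  assumes "g \<in> carrier_mat n n" "h \<in> carrier_mat n n" "x \<in> carrier_mat n n"
  shows "act q n (g * h) x = act q n g (act q n h x)"
  using assms
  by (simp add: act_def dagger_mult assoc_mult_mat[of _ n n _ n _ n] mult_carrier_mat[of _ n n _ n])

lemma act_one [simp]: "(x :: 'a mat) \<in> carrier_mat n n \<Longrightarrow> act q n (1\<^sub>m n) x = x"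
  by (simp add: act_def)

lemma act_skew:
  fixes g x :: "'a mat"
  assumes g: "g \<in> carrier_mat n n" and x: "x \<in> carrier_mat n n" "dagger q n x = - x"
  shows "dagger q n (act q n g x) = - act q n g x"
proof -
  have "dagger q n (act q n g x) = g * - x * dagger q n g"
    using assms by (simp add: act_def dagger_mult dagger_dagger assoc_mult_mat[of _ n n _ n _ n])
  then show ?thesis using assms by (simp add: act_def dim_dagger)
qed

lemma act_mem_uu:
  fixes g x :: "'a mat"
  assumes "g \<in> carrier (UT n)" "x \<in> uu q n"
  shows "act q n g x \<in> uu q n"
  using assms act_skew[of g n x] ut_mult_UT[OF dagger_mem_UT[OF assms(1)] UT_mult_ut[of g n x]]
  by (simp add: uu_def UT_carrier_mat mem_ut act_def)

lemma act_inv: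
  fixes g x :: "'a mat"
  assumes "g \<in> carrier (UT n)" "x \<in> carrier_mat n n"
  shows "act q n (inv\<^bsub>UT n\<^esub> g) (act q n g x) = x" "act q n g (act q n (inv\<^bsub>UT n\<^esub> g) x) = x"
  using assms UT_inv[OF assms(1)]
  by (simp_all add: UT_carrier_mat act_mult[symmetric])

lemma G_orbit_act:
  fixes g x :: "'a mat"
  assumes g: "g \<in> carrier (UT n)" and x: "x \<in> carrier_mat n n"
  shows "G_orbit q n (act q n g x) = G_orbit q n x"
proof
  show "G_orbit q n (act q n g x) \<subseteq> G_orbit q n x"
    using g x by (auto simp: G_orbit_def act_mult[symmetric] UT_carrier_mat mult_mem_UT)
  show "G_orbit q n x \<subseteq> G_orbit q n (act q n g x)"
  proof
    fix y assume "y \<in> G_orbit q n x"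
    then obtain h where h: "h \<in> carrier (UT n)" "y = act q n h x" by (auto simp: G_orbit_def)
    have "y = act q n (h * inv\<^bsub>UT n\<^esub> g) (act q n g x)"
      using g h x UT_inv[OF g] by (simp add: act_mult act_inv UT_carrier_mat)
    then show "y \<in> G_orbit q n (act q n g x)"
      using h(1) UT_inv[OF g] by (auto simp: G_orbit_def mult_mem_UT)
  qed
qed

text \<open>Stated for all skew \<open>x\<close>, not only for \<open>x\<close> in
  \<open>uu q n\<close>, because it is also applied to the transpose of a matrix that represents a
  functional.\<close>

lemma exists_act_monomial:
  fixes x :: "'a mat"
  assumes x: "x \<in> carrier_mat n n" and skew: "dagger q n x = - x"
  shows "\<exists>g\<in>carrier (UT n). monomial_mat n (act q n g x)"
proof -
  \<comment> \<open>The form with Gram matrix \<open>x * antidiag n\<close>. Entry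
    \<open>(i, j)\<close> of the transformed matrix is its value at the rows \<open>i\<close> and
    \<open>opp n j\<close> of \<open>g\<close>.\<close>
  define S where "S u v = (\<Sum>a<n. \<Sum>b<n. u a * x $$ (a, opp n b) * cj (v b))" for u v
  have x_opp: "x $$ (b, opp n a) = - cj (x $$ (a, opp n b))" if "a < n" "b < n" for a b
  proof -
    have "\<forall>i<n. \<forall>j<n. x $$ (opp n j, opp n i) = - cj (x $$ (i, j))"
      using dagger_eq_uminus_iff[OF x] skew by simp
    from this[rule_format, of a "opp n b"] that show ?thesis by simp
  qed
  have "\<exists>v. (\<forall>i<n. v i i = 1 \<and> (\<forall>a<i. v i a = 0)) \<and>
    (\<forall>i<n. \<forall>j<n. \<forall>k<n. S (v i) (v j) \<noteq> 0 \<longrightarrow> S (v i) (v k) \<noteq> 0 \<longrightarrow> j = k)"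
  proof (rule monomial_Gram_matrix)
    show "S (\<lambda>a. u a + c * v a) w = S u w + c * S v w" for c u v w
      by (simp add: S_def algebra_simps sum.distrib sum_distrib_left)
    show "S v u = - cj (S u v)" for u v
    proof -
      have "- cj (S u v) = (\<Sum>a<n. \<Sum>b<n. v b * (- cj (x $$ (a, opp n b))) * cj (u a))"
        by (simp add: S_def cj_sum sum_negf mult_ac)
      also have "\<dots> = (\<Sum>a<n. \<Sum>b<n. v b * x $$ (b, opp n a) * cj (u a))"
        by (intro sum.cong refl) (metis x_opp lessThan_iff)
      also have "\<dots> = S v u" unfolding S_def by (rule sum.swap)
      finally show ?thesis by simp
    qed
  qed
  then obtain v where flag: "\<forall>i<n. v i i = 1 \<and> (\<forall>a<i. v i a = 0)"
    and mono: "\<forall>i<n. \<forall>j<n. \<forall>k<n. S (v i) (v j) \<noteq> 0 \<longrightarrow> S (v i) (v k) \<noteq> 0 \<longrightarrow> j = k"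
    by blast
  define g where "g = mat n n (\<lambda>(i, a). v i a)"
  have g: "g \<in> carrier (UT n)" using flag by (simp add: g_def mem_UT)
  have gc: "g \<in> carrier_mat n n" by (simp add: g_def)
  let ?y = "act q n g x"
  have S_eq: "?y $$ (i, j) = S (v i) (v (opp n j))" if "i < n" "j < n" for i j
  proof -
    have "?y $$ (i, j) = (\<Sum>b<n. (\<Sum>a<n. v i a * x $$ (a, b)) * cj (v (opp n j) (opp n b)))"
      using that x gc unfolding act_def
      by (simp add: index_mult_sum[where n = n] index_dagger mult_carrier_mat[where n = n] g_def
          del: index_mult_mat)
    also have "\<dots> = (\<Sum>b<n. (\<Sum>a<n. v i a * x $$ (a, opp n b)) * cj (v (opp n j) (opp n (opp n b))))"
      by (rule sum_opp[symmetric])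
    also have "\<dots> = (\<Sum>b<n. \<Sum>a<n. v i a * x $$ (a, opp n b) * cj (v (opp n j) b))"
      by (simp add: sum_distrib_right)
    also have "\<dots> = S (v i) (v (opp n j))" unfolding S_def by (rule sum.swap)
    finally show ?thesis .
  qed
  have row: "j = k" if "i < n" "j < n" "k < n" "?y $$ (i, j) \<noteq> 0" "?y $$ (i, k) \<noteq> 0" for i j k
  proof -
    have "opp n j = opp n k"
      using that mono[rule_format, of i "opp n j" "opp n k"] by (simp add: S_eq)
    then show ?thesis using that by simp
  qed
  have yskew: "?y $$ (opp n j, opp n i) = - cj (?y $$ (i, j))" if "i < n" "j < n" for i j
    using that act_skew[OF gc x skew] dagger_eq_uminus_iff[of ?y n] gc by simp
  \<comment> \<open>Skewness carries column \<open>i\<close> to row \<open>opp n i\<close>, so the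
    bound for rows gives the one for columns.\<close>
  have "j = k" if "i < n" "j < n" "k < n" "?y $$ (j, i) \<noteq> 0" "?y $$ (k, i) \<noteq> 0" for i j k
  proof -
    have "?y $$ (opp n i, opp n j) \<noteq> 0" "?y $$ (opp n i, opp n k) \<noteq> 0"
      using that yskew[of j i] yskew[of k i] by simp_all
    then have "opp n j = opp n k" using that row[of "opp n i"] by simp
    then show ?thesis using that by simp
  qed
  then show ?thesis using row g by (intro bexI[of _ g]) (auto simp: monomial_mat_def)
qed

end

section \<open>The trace pairing\<close>

lemma sum_opp_opp: "(\<Sum>i<n. \<Sum>j<n. f (opp n j) (opp n i)) = (\<Sum>i<n. \<Sum>j<n. f i j)"
proof -
  have "(\<Sum>i<n. \<Sum>j<n. f (opp n j) (opp n i)) = (\<Sum>i<n. \<Sum>j<n. f j (opp n i))"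
    by (intro sum.cong refl sum_opp)
  also have "\<dots> = (\<Sum>i<n. \<Sum>j<n. f j i)"
    by (rule sum_opp)
  also have "\<dots> = (\<Sum>i<n. \<Sum>j<n. f i j)"
    by (rule sum.swap)
  finally show ?thesis .
qed

text \<open>This is the trace of \<open>transpose_mat z * x\<close>; hence the adjoint of
  multiplication by a matrix is multiplication by its transpose on the same side.\<close>

definition pairing :: "nat \<Rightarrow> 'a::comm_ring mat \<Rightarrow> 'a mat \<Rightarrow> 'a" where
  "pairing n z x = (\<Sum>i<n. \<Sum>j<n. z $$ (i, j) * x $$ (i, j))"

lemma pairing_mult_left:
  fixes a x z :: "'a::field mat"
  assumes a: "a \<in> carrier_mat n n" and x: "x \<in> carrier_mat n n" and z: "z \<in> carrier_mat n n"
  shows "pairing n z (a * x) = pairing n (transpose_mat a * z) x"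
proof -
  have "pairing n z (a * x) = (\<Sum>i<n. \<Sum>j<n. \<Sum>k<n. z $$ (i, j) * (a $$ (i, k) * x $$ (k, j)))"
    using a x by (simp add: pairing_def index_mult_sum[where n = n] sum_distrib_left del: index_mult_mat)
  also have "\<dots> = (\<Sum>i<n. \<Sum>k<n. \<Sum>j<n. z $$ (i, j) * (a $$ (i, k) * x $$ (k, j)))"
    by (intro sum.cong refl sum.swap)
  also have "\<dots> = (\<Sum>k<n. \<Sum>i<n. \<Sum>j<n. z $$ (i, j) * (a $$ (i, k) * x $$ (k, j)))"
    by (rule sum.swap)
  also have "\<dots> = (\<Sum>k<n. \<Sum>j<n. \<Sum>i<n. z $$ (i, j) * (a $$ (i, k) * x $$ (k, j)))"
    by (intro sum.cong refl sum.swap)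
  also have "\<dots> = pairing n (transpose_mat a * z) x"
    using a z by (simp add: pairing_def index_mult_sum[where n = n] sum_distrib_left
        sum_distrib_right ac_simps del: index_mult_mat)
  finally show ?thesis .
qed

lemma pairing_transpose:
  assumes "z \<in> carrier_mat n n" "x \<in> carrier_mat n n"
  shows "pairing n (transpose_mat z) (transpose_mat x) = pairing n z x"
proof -
  have "pairing n (transpose_mat z) (transpose_mat x) = (\<Sum>i<n. \<Sum>j<n. z $$ (j, i) * x $$ (j, i))"
    using assms by (simp add: pairing_def)
  also have "\<dots> = pairing n z x" unfolding pairing_def by (rule sum.swap)
  finally show ?thesis .
qed

lemma pairing_mult_right:
  fixes b x z :: "'a::field mat"
  assumes b: "b \<in> carrier_mat n n" and x: "x \<in> carrier_mat n n" and z: "z \<in> carrier_mat n n"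
  shows "pairing n z (x * b) = pairing n (z * transpose_mat b) x"
proof -
  have "pairing n z (x * b) = pairing n (transpose_mat z) (transpose_mat b * transpose_mat x)"
    using assms pairing_transpose[of z n "x * b"] by (simp add: transpose_mult[of _ n n _ n])
  also have "\<dots> = pairing n (transpose_mat (z * transpose_mat b)) (transpose_mat x)"
    using assms by (subst pairing_mult_left) (simp_all add: transpose_mult[of _ n n _ n])
  also have "\<dots> = pairing n (z * transpose_mat b) x"
    using assms by (intro pairing_transpose) simp_all
  finally show ?thesis .
qed

lemma pairing_add:
  "x \<in> carrier_mat n n \<Longrightarrow> y \<in> carrier_mat n n \<Longrightarrow> pairing n z (x + y) = pairing n z x + pairing n z y"
  by (simp add: pairing_def algebra_simps sum.distrib)

lemma pairing_smult:
  fixes z :: "'a::field mat"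
  shows "x \<in> carrier_mat n n \<Longrightarrow> pairing n z (c \<cdot>\<^sub>m x) = c * pairing n z x"
  by (simp add: pairing_def sum_distrib_left ac_simps)

section \<open>Set partitions as monomial matrices\<close>

lemma x_part_index:
  assumes "labeled_set_partition n \<eta>" "i < n" "j < n"
  shows "x_part n \<eta> $$ (i, j) = a \<longleftrightarrow> (i, a, j) \<in> \<eta> \<or> a = 0 \<and> (\<forall>b. (i, b, j) \<notin> \<eta>)"
proof (cases "\<exists>b. (i, b, j) \<in> \<eta>")
  case True
  then obtain b where b: "(i, b, j) \<in> \<eta>" by blast
  have uniq: "c = b" if "(i, c, j) \<in> \<eta>" for c
    using assms(1) b that unfolding labeled_set_partition_def by blast
  then have "(THE c. (i, c, j) \<in> \<eta>) = b" using b by blast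
  then have "x_part n \<eta> $$ (i, j) = b" using assms(2,3) True by (simp add: x_part_def)
  then show ?thesis using b uniq by blast
next
  case False
  then show ?thesis using assms(2,3) by (auto simp: x_part_def)
qed

lemma x_part_carrier_mat [simp]: "x_part n \<eta> \<in> carrier_mat n n"
  by (simp add: x_part_def)

lemma labeled_set_partitionD:
  assumes "labeled_set_partition n \<eta>" "(i, a, j) \<in> \<eta>"
  shows "i < j" "i < n" "j < n" "a \<noteq> 0"
  using assms unfolding labeled_set_partition_def by fastforce+

text \<open>The endpoints of an arc determine its label, so a sum over arcs is a sum over positions;
  all other positions have entry zero.\<close>

lemma sum_labeled_set_partition:
  fixes x :: "'a::field mat"
  assumes "labeled_set_partition n \<eta>"
  shows "(\<Sum>(i, a, j)\<in>\<eta>. a * x $$ (i, j)) = pairing n (x_part n \<eta>) x"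
proof -
  let ?X = "x_part n \<eta>" and ?B = "{(i, j). \<exists>a. (i, a, j) \<in> \<eta>}"
  have X: "?X $$ (i, j) = a" if "(i, a, j) \<in> \<eta>" for i a j
    using that labeled_set_partitionD[OF assms that] x_part_index[OF assms] by blast
  have X0: "?X $$ (i, j) = 0" if "i < n" "j < n" "(i, j) \<notin> ?B" for i j
    using that x_part_index[OF assms, of i j 0] by auto
  have "(\<Sum>(i, a, j)\<in>\<eta>. a * x $$ (i, j)) = (\<Sum>(i, j)\<in>?B. ?X $$ (i, j) * x $$ (i, j))"
    by (rule sum.reindex_bij_witness[of _ "\<lambda>(i, j). (i, ?X $$ (i, j), j)" "\<lambda>(i, a, j). (i, j)"])
      (auto simp: X)
  also have "\<dots> = (\<Sum>(i, j)\<in>{..<n} \<times> {..<n}. ?X $$ (i, j) * x $$ (i, j))"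
    using labeled_set_partitionD[OF assms] X0 by (intro sum.mono_neutral_left) fastforce+
  also have "\<dots> = pairing n ?X x" by (simp add: pairing_def sum.cartesian_product)
  finally show ?thesis .
qed

definition arcs_of_mat :: "nat \<Rightarrow> 'a::field mat \<Rightarrow> (nat \<times> 'a \<times> nat) set" where
  "arcs_of_mat n y = {(i, a, j). i < n \<and> j < n \<and> a = y $$ (i, j) \<and> a \<noteq> 0}"

lemma labeled_arcs_of_mat:
  assumes "y \<in> ut n" "monomial_mat n y"
  shows "labeled_set_partition n (arcs_of_mat n y)"
proof -
  have "i < j" if "i < n" "j < n" "y $$ (i, j) \<noteq> 0" for i j
    using that assms(1) by (meson linorder_not_less mem_ut)
  then have "\<forall>(i, a, j)\<in>arcs_of_mat n y. i < j \<and> j < n \<and> a \<noteq> 0"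
    by (auto simp: arcs_of_mat_def)
  moreover have "a = b \<and> j = k" if "(i, a, j) \<in> arcs_of_mat n y" "(i, b, k) \<in> arcs_of_mat n y"
    for i a j b k
    using that assms(2) unfolding arcs_of_mat_def monomial_mat_def by blast
  moreover have "a = b \<and> i = k" if "(i, a, j) \<in> arcs_of_mat n y" "(k, b, j) \<in> arcs_of_mat n y"
    for i a j b k
    using that assms(2) unfolding arcs_of_mat_def monomial_mat_def by blast
  ultimately show ?thesis unfolding labeled_set_partition_def by blast
qed

lemma x_part_arcs_of_mat:
  assumes "y \<in> ut n" "monomial_mat n y"
  shows "x_part n (arcs_of_mat n y) = y"
proof (rule eq_matI)
  fix i j assume "i < dim_row y" "j < dim_col y"
  then have "i < n" "j < n" using assms(1) by (auto simp: mem_ut)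
  then show "x_part n (arcs_of_mat n y) $$ (i, j) = y $$ (i, j)"
    using x_part_index[OF labeled_arcs_of_mat[OF assms]] by (auto simp: arcs_of_mat_def)
qed (use assms(1) in \<open>auto simp: mem_ut x_part_def\<close>)

context conjugation
begin

lemma mem_uu:
  "x \<in> uu q n \<longleftrightarrow> x \<in> ut n \<and> (\<forall>i<n. \<forall>j<n. x $$ (opp n j, opp n i) = - cj (x $$ (i, j)))"
  using dagger_eq_uminus_iff[of x n] by (auto simp: uu_def mem_ut)

lemma uu_carrier_mat:
  fixes x :: "'a mat"
  shows "x \<in> uu q n \<Longrightarrow> x \<in> carrier_mat n n"
  by (simp add: uu_def mem_ut)

lemma add_mem_uu:
  fixes x y :: "'a mat"
  shows "x \<in> uu q n \<Longrightarrow> y \<in> uu q n \<Longrightarrow> x + y \<in> uu q n"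
  by (auto simp: mem_uu mem_ut)

lemma smult_mem_uu:
  fixes x :: "'a mat"
  shows "c \<in> Fq q \<Longrightarrow> x \<in> uu q n \<Longrightarrow> c \<cdot>\<^sub>m x \<in> uu q n"
  by (auto simp: mem_uu mem_ut mem_Fq)

lemma twisted_arcs_of_mat:
  fixes y :: "'a mat"
  assumes "y \<in> uu q n" "monomial_mat n y"
  shows "twisted_set_partition q n (arcs_of_mat n y)"
  using assms labeled_arcs_of_mat[of y n]
  by (auto simp: twisted_set_partition_def arcs_of_mat_def mem_uu cj_power)

lemma x_part_mem_uu:
  fixes \<eta> :: "(nat \<times> 'a \<times> nat) set"
  assumes "twisted_set_partition q n \<eta>"
  shows "x_part n \<eta> \<in> uu q n"
proof -
  let ?X = "x_part n \<eta>"
  have lab: "labeled_set_partition n \<eta>" using assms by (simp add: twisted_set_partition_def)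
  have tw: "(opp n j, - cj a, opp n i) \<in> \<eta>" if "(i, a, j) \<in> \<eta>" for i a j
    using assms that unfolding twisted_set_partition_def cj_power by blast
  have "?X $$ (i, j) = 0" if "i < n" "j \<le> i" for i j
    using that labeled_set_partitionD[OF lab, of i _ j] x_part_index[OF lab, of i j 0] by force
  moreover have "?X $$ (opp n j, opp n i) = - cj (?X $$ (i, j))" if ij: "i < n" "j < n" for i j
  proof (cases "\<exists>a. (i, a, j) \<in> \<eta>")
    case True
    then obtain a where a: "(i, a, j) \<in> \<eta>" by blast
    then have "?X $$ (i, j) = a" "?X $$ (opp n j, opp n i) = - cj a"
      using ij tw[OF a] x_part_index[OF lab] by simp_all
    then show ?thesis by simp
  next
    case False
    \<comment> \<open>Reflection is an involution: an arc at the reflected position would force one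
      from \<open>i\<close> to \<open>j\<close>.\<close>
    have "(opp n j, a, opp n i) \<notin> \<eta>" for a
      using False tw[of "opp n j" a "opp n i"] ij by auto
    then have "?X $$ (opp n j, opp n i) = 0" "?X $$ (i, j) = 0"
      using False ij x_part_index[OF lab, of _ _ 0] by simp_all
    then show ?thesis by simp
  qed
  ultimately show ?thesis by (simp add: mem_uu mem_ut)
qed

section \<open>Functionals as pairings\<close>

lemma l_part_eq_pairing:
  fixes \<eta> :: "(nat \<times> 'a \<times> nat) set"
  assumes "labeled_set_partition n \<eta>"
  shows "l_part q n \<eta> = (\<lambda>x\<in>uu q n. pairing n (x_part n \<eta>) x)"
  using sum_labeled_set_partition[OF assms] by (simp add: l_part_def)

text \<open>Conjugating a term gives the term at the reflected position, since the two minus signs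
  cancel. So conjugation only permutes the summands.\<close>

lemma pairing_mem_Fq:
  fixes x z :: "'a mat"
  assumes z: "z \<in> uu q n" and x: "x \<in> uu q n"
  shows "pairing n z x \<in> Fq q"
proof -
  have "cj (pairing n z x) =
      (\<Sum>i<n. \<Sum>j<n. z $$ (opp n j, opp n i) * x $$ (opp n j, opp n i))"
    using z x by (simp add: pairing_def cj_sum mem_uu)
  also have "\<dots> = pairing n z x" unfolding pairing_def by (rule sum_opp_opp)
  finally show ?thesis by (simp add: mem_Fq)
qed

lemma l_part_mem_uu_dual:
  fixes \<eta> :: "(nat \<times> 'a \<times> nat) set"
  assumes "twisted_set_partition q n \<eta>"
  shows "l_part q n \<eta> \<in> uu_dual q n"
proof -
  have "labeled_set_partition n \<eta>" using assms by (simp add: twisted_set_partition_def)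
  from l_part_eq_pairing[OF this] show ?thesis
    using x_part_mem_uu[OF assms]
    by (auto simp: uu_dual_def pairing_mem_Fq add_mem_uu smult_mem_uu
        pairing_add pairing_smult uu_carrier_mat)
qed

text \<open>
  Composed with the projection of \<open>ut n\<close> onto \<open>uu q n\<close> along the Hermitian matrices, a functional
  is a sum of functionals of the single entries. On one entry, \<open>c = r + s * e\<close> with
  \<open>r, s \<in> Fq q\<close> and \<open>cj e = - e\<close>, whence it has the form \<open>c \<mapsto> b * c + cj (b * c)\<close>.
\<close>

lemma uu_dual_eq_pairing:
  fixes l :: "'a mat \<Rightarrow> 'a"
  assumes l: "l \<in> uu_dual q n"
  shows "\<exists>z\<in>carrier_mat n n. dagger q n z = - z \<and> (\<forall>x\<in>uu q n. l x = pairing n z x)"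
proof -
  obtain e :: 'a where e: "e \<noteq> 0" "cj e = - e" using skew_unit by blast
  have l_Fq: "cj (l x) = l x" if "x \<in> uu q n" for x
    using l that by (auto simp: uu_dual_def mem_Fq)
  have l_add: "l (x + y) = l x + l y" if "x \<in> uu q n" "y \<in> uu q n" for x y
    using l that by (simp add: uu_dual_def)
  have l_smult: "l (c \<cdot>\<^sub>m x) = c * l x" if "cj c = c" "x \<in> uu q n" for c x
    using l that by (simp add: uu_dual_def mem_Fq)
  define sk where "sk x = mat n n (\<lambda>(i, j). (x $$ (i, j) - cj (x $$ (opp n j, opp n i))) / 2)"
    for x :: "'a mat"
  have sk_uu: "sk x \<in> uu q n" if "x \<in> ut n" for x
  proof -
    have "x $$ (opp n j, opp n i) = 0" if "i < n" "j \<le> i" for i j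
    proof -
      have "opp n i \<le> opp n j" using that unfolding opp_def by linarith
      then show ?thesis using that \<open>x \<in> ut n\<close> by (simp add: mem_ut)
    qed
    then show ?thesis
      using that by (auto simp: mem_uu mem_ut sk_def minus_divide_left simp del: divide_minus_left)
  qed
  have sk_add: "sk (x + y) = sk x + sk y" if "x \<in> ut n" "y \<in> ut n" for x y
    using that by (intro eq_matI) (auto simp: sk_def mem_ut add_divide_distrib diff_divide_distrib)
  have sk_smult: "sk (c \<cdot>\<^sub>m x) = c \<cdot>\<^sub>m sk x" if "cj c = c" "x \<in> ut n" for c x
    using that by (intro eq_matI) (auto simp: sk_def mem_ut right_diff_distrib)
  have sk_id: "sk x = x" if "x \<in> uu q n" for x
  proof (rule eq_matI)
    fix i j assume "i < dim_row x" "j < dim_col x"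
    then have ij: "i < n" "j < n" using that by (auto simp: mem_uu mem_ut)
    have "cj (x $$ (opp n j, opp n i)) = - x $$ (i, j)" using that ij by (simp add: mem_uu)
    then have "sk x $$ (i, j) = (x $$ (i, j) + x $$ (i, j)) / 2" using ij by (simp add: sk_def)
    then show "sk x $$ (i, j) = x $$ (i, j)" by (simp add: mult_2[symmetric])
  qed (use that in \<open>auto simp: mem_uu mem_ut sk_def\<close>)
  define single where "single i j c = mat n n (\<lambda>ab. if ab = (i, j) then c else 0)"
    for i j and c :: 'a
  have single_ut: "single i j c \<in> ut n" if "i < j" for i j c
    using that by (auto simp: mem_ut single_def)
  \<comment> \<open>This solves \<open>b + cj b = L1\<close> and \<open>e * (b - cj b) = Le\<close>,
    where \<open>L1\<close> and \<open>Le\<close> are the values prescribed at \<open>c = 1\<close>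
    and \<open>c = e\<close>.\<close>
  define b where "b i j = (if i < j then
      l (sk (single i j 1)) / 2 + l (sk (single i j e)) / (2 * e) else 0)" for i j
  have l_single: "l (sk (single i j c)) = b i j * c + cj (b i j * c)" if "i < j" for i j c
  proof -
    define r where "r = (c + cj c) / 2"
    define s where "s = (c - cj c) / (2 * e)"
    define L1 where "L1 = l (sk (single i j 1))"
    define Le where "Le = l (sk (single i j e))"
    have "cj s = - ((cj c - c) / (2 * e))" using e by (simp add: s_def)
    also have "\<dots> = s" by (simp add: s_def minus_divide_left del: divide_minus_left)
    finally have rs: "cj r = r" "cj s = s" by (simp_all add: r_def add.commute)
    have L: "cj L1 = L1" "cj Le = Le"
      using that by (simp_all add: L1_def Le_def l_Fq sk_uu single_ut)
    have "r + s * e = (c + c) / 2"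
      using e(1) by (simp add: r_def s_def add_divide_distrib[symmetric])
    then have c: "c = r + s * e" by (simp add: mult_2[symmetric])
    have "single i j c = r \<cdot>\<^sub>m single i j 1 + s \<cdot>\<^sub>m single i j e"
      unfolding c by (intro eq_matI) (auto simp: single_def)
    moreover have "r \<cdot>\<^sub>m single i j 1 \<in> ut n" "s \<cdot>\<^sub>m single i j e \<in> ut n"
      using that by (auto simp: mem_ut single_def)
    ultimately have "l (sk (single i j c)) = r * L1 + s * Le"
      using that by (simp add: sk_add sk_smult rs single_ut l_add l_smult sk_uu smult_mem_uu
          mem_Fq L1_def Le_def)
    moreover have "b i j * c + cj (b i j * c) = r * L1 + s * Le"
    proof -
      define A B where "A = L1 / 2" and "B = Le / (2 * e)"
      have b: "b i j = A + B" using that by (simp add: b_def L1_def Le_def A_def B_def)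
      have AB: "cj A = A" "cj B = - B" using e L by (simp_all add: A_def B_def)
      have "b i j * c + cj (b i j * c) = (A + B) * c + (A - B) * cj c"
        by (simp add: b AB)
      also have "\<dots> = (c + cj c) * A + (c - cj c) * B"
        by (simp add: algebra_simps)
      finally have "b i j * c + cj (b i j * c) = (c + cj c) * A + (c - cj c) * B" .
      then show ?thesis by (simp add: r_def s_def A_def B_def)
    qed
    ultimately show ?thesis by simp
  qed
  have expand: "l x = (\<Sum>i<n. \<Sum>j<n. b i j * x $$ (i, j) + cj (b i j * x $$ (i, j)))"
    if x: "x \<in> uu q n" for x
  proof -
    let ?W = "\<lambda>A. mat n n (\<lambda>ab. if ab \<in> A then x $$ ab else 0)"
    let ?T = "{(i, j). i < j \<and> j < n}"
    have W: "?W A \<in> ut n" for A using x by (auto simp: mem_uu mem_ut)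
    have fin: "finite ?T" by (rule finite_subset[of _ "{..<n} \<times> {..<n}"]) auto
    have l_W: "l (sk (?W A)) = (\<Sum>(i, j)\<in>A. b i j * x $$ (i, j) + cj (b i j * x $$ (i, j)))"
      if "finite A" "A \<subseteq> ?T" for A
      using that
    proof (induction A rule: finite_induct)
      case empty
      \<comment> \<open>Writing the zero matrix as a multiple by 0 makes homogeneity of
        \<open>l\<close> yield the value 0.\<close>
      have "sk (?W {}) = 0 \<cdot>\<^sub>m sk (?W {})"
        by (intro eq_matI) (auto simp: sk_def)
      then have "l (sk (?W {})) = l (0 \<cdot>\<^sub>m sk (?W {}))" by (rule arg_cong)
      also have "\<dots> = 0 * l (sk (?W {}))" by (intro l_smult sk_uu W) simp
      finally show ?case by simp
    next
      case (insert ij A)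
      obtain i j where ij: "ij = (i, j)" by (cases ij)
      have "i < j" using insert.prems ij by auto
      have "?W (insert ij A) = single i j (x $$ (i, j)) + ?W A"
        using insert.hyps(2) by (intro eq_matI) (auto simp: ij single_def)
      then have "l (sk (?W (insert ij A))) = l (sk (single i j (x $$ (i, j)))) + l (sk (?W A))"
        using \<open>i < j\<close> W[of A] by (simp only: sk_add single_ut l_add sk_uu)
      then show ?case using insert l_single[OF \<open>i < j\<close>] by (simp add: ij)
    qed
    have "?W ?T = x" using x by (intro eq_matI) (auto simp: mem_uu mem_ut)
    then have "l x = (\<Sum>(i, j)\<in>?T. b i j * x $$ (i, j) + cj (b i j * x $$ (i, j)))"
      using l_W[OF fin order.refl] sk_id[OF x] by simp
    also have "\<dots> = (\<Sum>(i, j)\<in>{..<n} \<times> {..<n}. b i j * x $$ (i, j) + cj (b i j * x $$ (i, j)))"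
      by (intro sum.mono_neutral_left) (auto simp: b_def split: if_splits)
    finally show ?thesis by (simp add: sum.cartesian_product)
  qed
  \<comment> \<open>The conjugated terms of the expansion are moved to the reflected position, where
    skewness of \<open>x\<close> turns them into linear terms in \<open>x $$ (i, j)\<close> with a
    minus sign.\<close>
  define z where "z = mat n n (\<lambda>(i, j). b i j - cj (b (opp n j) (opp n i)))"
  have z: "z \<in> carrier_mat n n" by (simp add: z_def)
  moreover have "dagger q n z = - z"
    unfolding dagger_eq_uminus_iff[OF z] by (simp add: z_def)
  moreover have "l x = pairing n z x" if x: "x \<in> uu q n" for x
  proof -
    have "(\<Sum>i<n. \<Sum>j<n. cj (b i j * x $$ (i, j))) =
        (\<Sum>i<n. \<Sum>j<n. cj (b (opp n j) (opp n i) * x $$ (opp n j, opp n i)))"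
      by (rule sum_opp_opp[symmetric])
    also have "\<dots> = (\<Sum>i<n. \<Sum>j<n. - cj (b (opp n j) (opp n i)) * x $$ (i, j))"
      using x by (intro sum.cong refl) (simp add: mem_uu)
    finally show ?thesis
      by (simp add: expand[OF x] pairing_def z_def sum.distrib left_diff_distrib sum_subtractf sum_negf)
  qed
  ultimately show ?thesis by blast
qed

section \<open>Invariance of supercharacters under the dual action\<close>

lemma act_dual_mult:
  fixes g h :: "'a mat"
  assumes "g \<in> carrier (UT n)" "h \<in> carrier (UT n)"
  shows "act_dual q n (g * h) l = act_dual q n g (act_dual q n h l)"
proof -
  have "inv\<^bsub>UT n\<^esub> (g * h) = inv\<^bsub>UT n\<^esub> h * inv\<^bsub>UT n\<^esub> g"
    using group.inv_mult_group[OF group_UT assms] by (simp add: UT_mult)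
  then show ?thesis
    using UT_inv(1)[OF assms(1)] UT_inv(1)[OF assms(2)]
    by (auto simp: act_dual_def act_mem_uu act_mult UT_carrier_mat uu_carrier_mat intro!: restrict_ext)
qed

lemma act_dual_inv:
  fixes g :: "'a mat"
  assumes "g \<in> carrier (UT n)" "l \<in> uu_dual q n"
  shows "act_dual q n (inv\<^bsub>UT n\<^esub> g) (act_dual q n g l) = l"
proof -
  have "inv\<^bsub>UT n\<^esub> (1\<^sub>m n) = (1\<^sub>m n :: 'a mat)"
    using group.is_monoid[OF group_UT] monoid.inv_one[of "UT n"] UT_one by metis
  \<comment> \<open>Off \<open>uu q n\<close> the restricted function is \<open>undefined\<close>,
    so the identity fixes \<open>l\<close> only because \<open>l\<close> is extensional.\<close>
  moreover have "l \<in> extensional (uu q n)" using assms(2) by (auto simp: uu_dual_def PiE_def)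
  ultimately have "act_dual q n (1\<^sub>m n) l = l"
    by (auto simp: act_dual_def uu_carrier_mat fun_eq_iff extensional_def)
  then show ?thesis
    using assms(1) UT_inv[OF assms(1)] by (simp add: act_dual_mult[symmetric])
qed

lemma G_orbit_dual_act_subset:
  fixes g :: "'a mat"
  assumes "g \<in> carrier (UT n)"
  shows "G_orbit_dual q n (act_dual q n g l) \<subseteq> G_orbit_dual q n l"
  using assms by (auto simp: G_orbit_dual_def act_dual_mult[symmetric] mult_mem_UT)

text \<open>\<open>HH n\<close> is normal in \<open>UT n\<close>, hence the orbits of \<open>HH n\<close> are permuted by \<open>UT n\<close>.\<close>

lemma H_orbit_dual_act_subset:
  fixes g :: "'a mat"
  assumes g: "g \<in> carrier (UT n)"
  shows "H_orbit_dual q n (act_dual q n g l) \<subseteq> act_dual q n g ` H_orbit_dual q n l"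
proof
  fix m assume "m \<in> H_orbit_dual q n (act_dual q n g l)"
  then obtain h where h: "h \<in> HH n" "m = act_dual q n h (act_dual q n g l)"
    by (auto simp: H_orbit_dual_def)
  let ?k = "inv\<^bsub>UT n\<^esub> g * h * g"
  have k: "?k \<in> HH n" by (rule conj_mem_HH[OF g h(1)])
  have hU: "h \<in> carrier (UT n)" "?k \<in> carrier (UT n)" using HH_subset_UT h(1) k by auto
  have "g * ?k = (g * inv\<^bsub>UT n\<^esub> g) * h * g"
    using UT_carrier_mat[OF g] UT_carrier_mat[OF hU(1)] UT_carrier_mat[OF UT_inv(1)[OF g]]
    by (simp add: assoc_mult_mat[of _ n n _ n _ n] mult_carrier_mat[of _ n n _ n])
  also have "\<dots> = h * g"
    using UT_carrier_mat[OF hU(1)] by (simp add: UT_inv(3)[OF g])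
  finally have "m = act_dual q n g (act_dual q n ?k l)"
    using h(2) g hU by (simp add: act_dual_mult[symmetric])
  then show "m \<in> act_dual q n g ` H_orbit_dual q n l"
    using k by (auto simp: H_orbit_dual_def)
qed

lemma card_H_orbit_dual_act_le:
  fixes g :: "'a mat"
  assumes "g \<in> carrier (UT n)"
  shows "card (H_orbit_dual q n (act_dual q n g l)) \<le> card (H_orbit_dual q n l)"
proof -
  have "finite (carrier (UT n) :: 'a mat set)"
    by (rule finite_subset[OF _ finite_carrier_mat[of n n]]) (auto simp: mem_UT)
  then have "finite (H_orbit_dual q n l)"
    unfolding H_orbit_dual_def by (intro finite_imageI finite_subset[OF HH_subset_UT])
  then show ?thesis
    using H_orbit_dual_act_subset[OF assms, of l] card_image_le card_mono finite_imageI
    by (meson order.trans)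
qed

text \<open>The formula depends on \<open>l\<close> only through its \<open>G\<close>-orbit and the
  size of its \<open>H\<close>-orbit. The one-sided bounds above become equalities when they are
  also applied to the inverse of \<open>g\<close>.\<close>

lemma supercharacter_act_dual:
  fixes g :: "'a mat"
  assumes g: "g \<in> carrier (UT n)" and l: "l \<in> uu_dual q n"
  shows "supercharacter q n f \<theta> (act_dual q n g l) = supercharacter q n f \<theta> l"
proof -
  have "G_orbit_dual q n (act_dual q n g l) = G_orbit_dual q n l"
    using G_orbit_dual_act_subset[OF g, of l]
      G_orbit_dual_act_subset[OF UT_inv(1)[OF g], of "act_dual q n g l"] act_dual_inv[OF g l]
    by auto
  moreover have "card (H_orbit_dual q n (act_dual q n g l)) = card (H_orbit_dual q n l)"
    using card_H_orbit_dual_act_le[OF g, of l]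
      card_H_orbit_dual_act_le[OF UT_inv(1)[OF g], of "act_dual q n g l"] act_dual_inv[OF g l]
    by simp
  ultimately show ?thesis by (simp add: supercharacter_def)
qed

section \<open>Representatives of the orbits\<close>

lemma exists_act_x_part:
  fixes x :: "'a mat"
  assumes x: "x \<in> uu q n"
  shows "\<exists>g\<in>carrier (UT n). \<exists>\<eta>. twisted_set_partition q n \<eta> \<and> act q n g x = x_part n \<eta>"
proof -
  obtain g where g: "g \<in> carrier (UT n)" and mono: "monomial_mat n (act q n g x)"
    using exists_act_monomial[of x n] x by (auto simp: uu_def mem_ut)
  have y: "act q n g x \<in> uu q n" by (rule act_mem_uu[OF g x])
  then show ?thesis
    using g twisted_arcs_of_mat[OF y mono] x_part_arcs_of_mat[OF _ mono] by (metis mem_uu)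
qed

text \<open>
  If \<open>l\<close> is the pairing with \<open>z\<close>, then acting by the inverse of \<open>dagger q n g\<close> replaces the
  transpose of \<open>z\<close> by its image under \<open>g\<close>. So the normal form of skew-Hermitian matrices applies
  to functionals as well, where the entries on and below the diagonal can be dropped.
\<close>

lemma exists_act_dual_l_part:
  fixes l :: "'a mat \<Rightarrow> 'a"
  assumes l: "l \<in> uu_dual q n"
  shows "\<exists>g\<in>carrier (UT n). \<exists>\<eta>. twisted_set_partition q n \<eta> \<and> act_dual q n g l = l_part q n \<eta>"
proof -
  obtain z where z: "z \<in> carrier_mat n n" "dagger q n z = - z"
    and l_z: "\<And>x. x \<in> uu q n \<Longrightarrow> l x = pairing n z x"
    using uu_dual_eq_pairing[OF l] by blast
  let ?y = "transpose_mat z"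
  have y: "?y \<in> carrier_mat n n" using z(1) by simp
  have y_skew: "dagger q n ?y = - ?y"
    using z dagger_eq_uminus_iff[OF z(1)] dagger_eq_uminus_iff[OF y] by simp
  obtain g where g: "g \<in> carrier (UT n)" and mono: "monomial_mat n (act q n g ?y)"
    using exists_act_monomial[OF y y_skew] by blast
  have gc: "g \<in> carrier_mat n n" by (rule UT_carrier_mat[OF g])
  define m where "m = act q n g ?y"
  have m: "m \<in> carrier_mat n n" using gc by (simp add: m_def)
  have m_skew: "m $$ (opp n j, opp n i) = - cj (m $$ (i, j))" if "i < n" "j < n" for i j
    using act_skew[OF gc y y_skew] dagger_eq_uminus_iff[OF m] that by (simp add: m_def)
  \<comment> \<open>The reflection of positions preserves \<open>i < j\<close>, so truncating to the
    strict upper triangle keeps the matrix skew as well as monomial.\<close>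
  define t where "t = mat n n (\<lambda>(i, j). if i < j then m $$ (j, i) else 0)"
  have t: "t \<in> uu q n"
    using m_skew by (auto simp: mem_uu mem_ut t_def opp_less_opp_iff)
  have t_mono: "monomial_mat n t"
    using mono by (auto simp: monomial_mat_def t_def m_def[symmetric])
  let ?h = "dagger q n g"
  have h: "?h \<in> carrier (UT n)" by (rule dagger_mem_UT[OF g])
  have t_ut: "t \<in> ut n" using t by (simp add: uu_def)
  have "l (act q n ?h x) = pairing n t x" if x: "x \<in> uu q n" for x
  proof -
    have xc: "x \<in> carrier_mat n n" by (rule uu_carrier_mat[OF x])
    have "l (act q n ?h x) = pairing n z (?h * x * g)"
      using l_z[OF act_mem_uu[OF h x]] by (simp add: act_def dagger_dagger[OF gc])
    also have "\<dots> = pairing n (z * transpose_mat g) (?h * x)"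
      using gc xc z(1) by (intro pairing_mult_right mult_carrier_mat[of _ n n _ n]) simp_all
    also have "\<dots> = pairing n (transpose_mat ?h * (z * transpose_mat g)) x"
      using gc xc z(1) by (intro pairing_mult_left mult_carrier_mat[of _ n n _ n]) simp_all
    \<comment> \<open>Here \<open>m\<close> is \<open>g * ?y * ?h\<close>, and transposing reverses
      the product.\<close>
    also have "transpose_mat ?h * (z * transpose_mat g) = transpose_mat m"
      using gc z(1) by (simp add: m_def act_def transpose_mult[of _ n n _ n] mult_carrier_mat[of _ n n _ n])
    also have "pairing n (transpose_mat m) x = pairing n t x"
      unfolding pairing_def using m x
      by (intro sum.cong refl) (auto simp: t_def mem_uu mem_ut)
    finally show ?thesis .
  qed
  moreover have "inv\<^bsub>UT n\<^esub> (inv\<^bsub>UT n\<^esub> ?h) = ?h"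
    by (rule group.inv_inv[OF group_UT h])
  moreover have "l_part q n (arcs_of_mat n t) = (\<lambda>x\<in>uu q n. pairing n t x)"
    using l_part_eq_pairing[OF labeled_arcs_of_mat[OF t_ut t_mono]]
    by (simp add: x_part_arcs_of_mat[OF t_ut t_mono])
  ultimately have "act_dual q n (inv\<^bsub>UT n\<^esub> ?h) l = l_part q n (arcs_of_mat n t)"
    by (simp add: act_dual_def cong: restrict_cong)
  then show ?thesis
    using UT_inv(1)[OF h] twisted_arcs_of_mat[OF t t_mono] by blast
qed

end

section \<open>Superclasses and supercharacters from twisted set partitions\<close>

theorem corollary7p4:
  fixes p k q n :: nat
    and f :: "'a::{field,finite} mat \<Rightarrow> 'a mat"
    and \<theta> :: "'a \<Rightarrow> complex"
  assumes "prime p" and "odd p" and "k \<ge> 1" and "q = p ^ k"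
    and "CARD('a) = q ^ 2"
    and "springer_morphism q n f"
    and "nontrivial_additive_character q \<theta>"
  shows "{superclass q n f u | u. u \<in> UU q n} =
           {superclass q n f (u_part q n f \<eta>) | \<eta>. twisted_set_partition q n \<eta>}
       \<and> {supercharacter q n f \<theta> l | l. l \<in> uu_dual q n} =
           {supercharacter q n f \<theta> (l_part q n \<eta>) | \<eta>. twisted_set_partition q n \<eta>}"
proof
  interpret conjugation q "\<lambda>c::'a. c ^ q"
    by (rule conjugation_power) (use assms in simp_all)
  have "inj_on f (carrier (UT n))" and f_UU: "f ` UU q n = uu q n"
    using assms(6) by (auto simp: springer_morphism_def bij_betw_def)
  then have inj: "inj_on f (UU q n)" by (auto simp: UU_def intro: inj_on_subset)
  \<comment> \<open>\<open>f\<close> restricts to a bijection from \<open>UU q n\<close> onto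
    \<open>uu q n\<close>, so the inverse in \<open>u_part\<close> is meaningful at
    \<open>x_part n \<eta>\<close>.\<close>
  have u_part: "u_part q n f \<eta> \<in> UU q n" "f (u_part q n f \<eta>) = x_part n \<eta>"
    if "twisted_set_partition q n \<eta>" for \<eta>
    using x_part_mem_uu[OF that] f_UU the_inv_into_into[OF inj, of "x_part n \<eta>"]
      f_the_inv_into_f[OF inj] by (auto simp: u_part_def)
  show "{superclass q n f u | u. u \<in> UU q n} =
      {superclass q n f (u_part q n f \<eta>) | \<eta>. twisted_set_partition q n \<eta>}"
  proof (intro equalityI subsetI)
    fix K assume "K \<in> {superclass q n f u | u. u \<in> UU q n}"
    then obtain u where u: "u \<in> UU q n" "K = superclass q n f u" by blast
    have fu: "f u \<in> uu q n" using u(1) f_UU by blast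
    then obtain g \<eta> where g: "g \<in> carrier (UT n)" and \<eta>: "twisted_set_partition q n \<eta>"
      "act q n g (f u) = x_part n \<eta>"
      using exists_act_x_part by blast
    \<comment> \<open>A superclass depends on \<open>u\<close> only through the orbit of
      \<open>f u\<close>.\<close>
    then have "G_orbit q n (f (u_part q n f \<eta>)) = G_orbit q n (f u)"
      using G_orbit_act[OF g uu_carrier_mat[OF fu]] u_part(2) by simp
    then show "K \<in> {superclass q n f (u_part q n f \<eta>) | \<eta>. twisted_set_partition q n \<eta>}"
      using u(2) \<eta>(1) by (auto simp: superclass_def)
  qed (use u_part(1) in blast)
  show "{supercharacter q n f \<theta> l | l. l \<in> uu_dual q n} =
      {supercharacter q n f \<theta> (l_part q n \<eta>) | \<eta>. twisted_set_partition q n \<eta>}"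
  proof (intro equalityI subsetI)
    fix X assume "X \<in> {supercharacter q n f \<theta> l | l. l \<in> uu_dual q n}"
    then obtain l where l: "l \<in> uu_dual q n" "X = supercharacter q n f \<theta> l" by blast
    then show "X \<in> {supercharacter q n f \<theta> (l_part q n \<eta>) | \<eta>. twisted_set_partition q n \<eta>}"
      using exists_act_dual_l_part[OF l(1)] supercharacter_act_dual[OF _ l(1)]
      by (metis (mono_tags, lifting) mem_Collect_eq)
  qed (use l_part_mem_uu_dual in blast)
qed

end
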